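(* Let $q\in\mathbb{C}^\times$ be a root of unity with $l\ge2$ minimal such that $q^{2l}=1$ and $\delta=q+q^{-1}\ge0$. Let $\chi_{\infty,l}$ be the extremal trace on $TL_\infty(\delta)$ with real parameter $\gamma>0$. If $\gamma\ne\delta^{-2}$ (a condition regarded as automatically satisfied when $\delta=0$), then the inner product on $TL_\infty(\delta)$ defined by $$\langle x,y\rangle_\chi:=\chi_{\infty,l}(xy^* )$$ is indefinite.
   Context: $TL_n(\delta)$ is the unital complex algebra with generators $e_1,\dots,e_{n-1}$ and relations $e_i^2=\delta e_i$, $e_ie_{i\pm1}e_i=e_i$, $e_ie_j=e_je_i$ for $|i-j|>1$; $TL_n\subset TL_{n+1}$ and $TL_\infty=\bigcup_nTL_n$. $*$ is the conjugate-linear involution with $e_i^*=e_i$, $(ab)^*=b^*a^*$. The extremal trace $\chi_{\infty,l}$ with parameter $\gamma$ is the trace on $TL_\infty$ whose restriction to $TL_n$ is $\sum_ic_{n,i}t_{n,i}$, where $t_{n,i}$, $0\le i\le\lfloor n/2\rfloor$, is the un-normalized matrix trace on the standard representation $\mathcal{V}_{n,i}$ (basis: link states on $n$ points with $i$ cups and $n-2i$ through strands; action by concatenation of diagrams, closed loops replaced by $\delta$, results with more than $i$ cups set to $0$), $c_{0,0}=c_{1,0}=1$, $c_{n,0}=c_{n-1,0}-\gamma c_{n-2,0}$ for $n\ge2$, and $c_{n,i}=\gamma^ic_{n-2i,0}$. "Inner product" here means a Hermitian sesquilinear form, with no positivity or non-degeneracy required; write $\|x\|^2=\langle x,x\rangle_\chi$.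 An inner product on a space $V$ is called indefinite if the set $\{x\in V:\|x\|^2=0\}$ is non-empty and not linearly closed (i.e. not a linear subspace). *)

theory Defs
  imports
    Complex_Main
    "HOL-Library.Poly_Mapping"
    "HOL-Algebra.Module"
    "HOL-Algebra.QuotRing"
begin

section \<open>The Temperley-Lieb algebras\<close>

text \<open>Words (lists of generator indices) form a monoid under concatenation, written additively so that
  finitely supported functions on words carry the convolution product of \<^theory>\<open>HOL-Library.Poly_Mapping\<close>:
  this is the free unital complex algebra.\<close>

datatype tl_word = Word (letters: "nat list")

instantiation tl_word :: monoid_add
begin
definition zero_tl_word_def: "0 = Word []"
definition plus_tl_word_def: "v + w = Word (letters v @ letters w)"
instance by standard (simp_all add: zero_tl_word_def plus_tl_word_def)
end

type_synonym free = "tl_word \<Rightarrow>\<^sub>0 complex"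

definition scal :: "complex \<Rightarrow> free" where
  "scal c = Poly_Mapping.single 0 c"

definition gen :: "nat \<Rightarrow> free" where
  "gen k = Poly_Mapping.single (Word [k]) 1"

definition free_alg :: "nat set \<Rightarrow> free ring" where
  "free_alg S = \<lparr>carrier = {a. \<forall>w\<in>Poly_Mapping.keys a. set (letters w) \<subseteq> S},
     mult = (*), one = 1, zero = 0, add = (+)\<rparr>"

definition tl_relations :: "complex \<Rightarrow> nat set \<Rightarrow> free set" where
  "tl_relations \<delta> S =
     {gen i * gen i - scal \<delta> * gen i | i. i \<in> S}
   \<union> {gen i * gen j * gen i - gen i | i j. i \<in> S \<and> j \<in> S \<and> (j = i + 1 \<or> i = j + 1)}
   \<union> {gen i * gen j - gen j * gen i | i j. i \<in> S \<and> j \<in> S \<and> \<bar>int i - int j\<bar> > 1}"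

definition tl_ideal :: "complex \<Rightarrow> nat set \<Rightarrow> free set" where
  "tl_ideal \<delta> S = genideal (free_alg S) (tl_relations \<delta> S)"

text \<open>The algebra presented by the generators \<open>e\<^sub>k\<close>, \<open>k \<in> S\<close>, and the Temperley-Lieb relations among
  them, as a quotient ring (its elements are cosets) together with its complex scalar
  multiplication.\<close>

definition tl_alg :: "complex \<Rightarrow> nat set \<Rightarrow> (complex, free set) module" where
  "tl_alg \<delta> S =
     ring.extend (free_alg S Quot tl_ideal \<delta> S)
       (module.fields (\<lambda>c X. (tl_ideal \<delta> S +>\<^bsub>free_alg S\<^esub> scal c) \<otimes>\<^bsub>free_alg S Quot tl_ideal \<delta> S\<^esub> X))"

definition TL :: "complex \<Rightarrow> nat \<Rightarrow> (complex, free set) module" where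
  "TL \<delta> n = tl_alg \<delta> {1..<n}"

text \<open>The union of the \<open>TL\<^sub>n\<close> is the algebra presented by all the generators \<open>e\<^sub>1, e\<^sub>2, \<dots>\<close> and all the
  relations; \<open>TL_incl\<close> is the canonical map of \<open>TL\<^sub>n\<close> into it, enlarging a coset of the smaller ideal
  to the coset of the larger one.\<close>

definition TL_inf :: "complex \<Rightarrow> (complex, free set) module" where
  "TL_inf \<delta> = tl_alg \<delta> {1..}"

definition TL_incl :: "complex \<Rightarrow> free set \<Rightarrow> free set" where
  "TL_incl \<delta> x = tl_ideal \<delta> {1..} <+>\<^bsub>free_alg {1..}\<^esub> x"

text \<open>The conjugate-linear involution reverses words and conjugates coefficients; it preserves the
  ideal, so on a coset it acts as direct image.\<close>

definition free_star :: "free \<Rightarrow> free" where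
  "free_star a = Poly_Mapping.map_key (\<lambda>w. Word (rev (letters w))) (Poly_Mapping.map cnj a)"

definition tl_star :: "free set \<Rightarrow> free set" where
  "tl_star x = free_star ` x"


section \<open>Standard representations\<close>

text \<open>A link state on the points \<open>1, \<dots>, n\<close> is encoded by the involution exchanging the two ends of
  each cup and fixing the through strands (and everything outside \<open>{1..n}\<close>). Planarity: a point
  strictly below a cup is itself an end of a cup lying below that cup; in particular no through
  strand starts below a cup.\<close>

definition link_states :: "nat \<Rightarrow> nat \<Rightarrow> (nat \<Rightarrow> nat) set" where
  "link_states n i = {p. (\<forall>j. p (p j) = j) \<and> (\<forall>j. j \<notin> {1..n} \<longrightarrow> p j = j)
     \<and> (\<forall>a b. a < b \<and> b < p a \<longrightarrow> p b \<noteq> b \<and> a < p b \<and> p b < p a)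
     \<and> card {a. a < p a} = i}"

text \<open>Concatenating the diagram \<open>e\<^sub>k\<close> with \<open>p\<close>, closed loop discarded: \<open>k\<close> and \<open>k + 1\<close> become the ends of
  a cup, and the strands of \<open>p\<close> that ended there are joined, so that a former partner of \<open>k\<close> is now
  linked to the former partner of \<open>k + 1\<close>, or carries a through strand if \<open>k + 1\<close> did, and vice versa.
  If both points carried through strands, the number of cups goes up by one. If \<open>k\<close> and \<open>k + 1\<close> were
  linked to each other, the result is \<open>p\<close> again.\<close>

definition join :: "nat \<Rightarrow> (nat \<Rightarrow> nat) \<Rightarrow> nat \<Rightarrow> nat" where
  "join k p j =
     (if j = k then k + 1
      else if j = k + 1 then k
      else if p j = k then (if p (k + 1) = k + 1 then j else p (k + 1))
      else if p j = k + 1 then (if p k = k then j else p k)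
      else p j)"

text \<open>Matrix entry of \<open>e\<^sub>k\<close> from the basis state \<open>p\<close> to the basis state \<open>r\<close>. A closed loop arises exactly
  if \<open>p\<close> links \<open>k\<close> and \<open>k + 1\<close>. Results with more than \<open>i\<close> cups are outside \<open>link_states n i\<close>, hence do
  not contribute to matrices over this index set.\<close>

definition gen_matrix :: "complex \<Rightarrow> nat \<Rightarrow> (nat \<Rightarrow> nat) \<Rightarrow> (nat \<Rightarrow> nat) \<Rightarrow> complex" where
  "gen_matrix \<delta> k r p = (if r = join k p then (if p k = k + 1 then \<delta> else 1) else 0)"

fun word_matrix :: "complex \<Rightarrow> nat \<Rightarrow> nat \<Rightarrow> nat list \<Rightarrow> (nat \<Rightarrow> nat) \<Rightarrow> (nat \<Rightarrow> nat) \<Rightarrow> complex" where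
  "word_matrix \<delta> n i [] r p = (if r = p then 1 else 0)"
| "word_matrix \<delta> n i (k # ks) r p =
     (\<Sum>s\<in>link_states n i. gen_matrix \<delta> k r s * word_matrix \<delta> n i ks s p)"

definition std_matrix :: "complex \<Rightarrow> nat \<Rightarrow> nat \<Rightarrow> free \<Rightarrow> (nat \<Rightarrow> nat) \<Rightarrow> (nat \<Rightarrow> nat) \<Rightarrow> complex" where
  "std_matrix \<delta> n i a r p =
     (\<Sum>w\<in>Poly_Mapping.keys a. Poly_Mapping.lookup a w * word_matrix \<delta> n i (letters w) r p)"

definition std_trace :: "complex \<Rightarrow> nat \<Rightarrow> nat \<Rightarrow> free \<Rightarrow> complex" where
  "std_trace \<delta> n i a = (\<Sum>p\<in>link_states n i. std_matrix \<delta> n i a p p)"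


section \<open>Extremal traces\<close>

fun ext_coeff0 :: "real \<Rightarrow> nat \<Rightarrow> real" where
  "ext_coeff0 \<gamma> 0 = 1"
| "ext_coeff0 \<gamma> (Suc 0) = 1"
| "ext_coeff0 \<gamma> (Suc (Suc n)) = ext_coeff0 \<gamma> (Suc n) - \<gamma> * ext_coeff0 \<gamma> n"

definition ext_coeff :: "real \<Rightarrow> nat \<Rightarrow> nat \<Rightarrow> real" where
  "ext_coeff \<gamma> n i = \<gamma> ^ i * ext_coeff0 \<gamma> (n - 2 * i)"

definition is_trace :: "(complex, 'a) module \<Rightarrow> ('a \<Rightarrow> complex) \<Rightarrow> bool" where
  "is_trace A \<chi> \<longleftrightarrow>
     (\<forall>x\<in>carrier A. \<forall>y\<in>carrier A. \<chi> (x \<oplus>\<^bsub>A\<^esub> y) = \<chi> x + \<chi> y) \<and>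
     (\<forall>c. \<forall>x\<in>carrier A. \<chi> (c \<odot>\<^bsub>A\<^esub> x) = c * \<chi> x) \<and>
     (\<forall>x\<in>carrier A. \<forall>y\<in>carrier A. \<chi> (x \<otimes>\<^bsub>A\<^esub> y) = \<chi> (y \<otimes>\<^bsub>A\<^esub> x))"

text \<open>\<open>\<chi>\<close> is the trace whose restriction to each \<open>TL\<^sub>n\<close> is the given combination of matrix traces. The
  matrices satisfy the Temperley-Lieb relations, so the trace of the action of \<open>x \<in> TL\<^sub>n\<close> may be
  computed from any representative \<open>a\<close> of the coset \<open>x\<close>. The restrictions are compatible for different
  \<open>n\<close>, by \<open>c\<^sub>n\<^sub>,\<^sub>i + c\<^sub>n\<^sub>,\<^sub>i\<^sub>+\<^sub>1 = c\<^sub>n\<^sub>-\<^sub>1\<^sub>,\<^sub>i\<close> and the branching rule, so such a \<open>\<chi>\<close> exists; it is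
  determined on the carrier.\<close>

definition extremal_trace :: "complex \<Rightarrow> real \<Rightarrow> (free set \<Rightarrow> complex) \<Rightarrow> bool" where
  "extremal_trace \<delta> \<gamma> \<chi> \<longleftrightarrow> is_trace (TL_inf \<delta>) \<chi> \<and>
     (\<forall>n. \<forall>x\<in>carrier (TL \<delta> n). \<forall>a\<in>x.
        \<chi> (TL_incl \<delta> x) = (\<Sum>i\<le>n div 2. complex_of_real (ext_coeff \<gamma> n i) * std_trace \<delta> n i a))"

definition chi_form :: "complex \<Rightarrow> (free set \<Rightarrow> complex) \<Rightarrow> free set \<Rightarrow> free set \<Rightarrow> complex" where
  "chi_form \<delta> \<chi> x y = \<chi> (x \<otimes>\<^bsub>TL_inf \<delta>\<^esub> tl_star y)"


section \<open>Indefinite inner products\<close>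

definition complex_field :: "complex ring" where
  "complex_field = \<lparr>carrier = UNIV, mult = (*), one = 1, zero = 0, add = (+)\<rparr>"

definition inner_product_on :: "(complex, 'a) module \<Rightarrow> ('a \<Rightarrow> 'a \<Rightarrow> complex) \<Rightarrow> bool" where
  "inner_product_on V f \<longleftrightarrow>
     (\<forall>x\<in>carrier V. \<forall>y\<in>carrier V. \<forall>z\<in>carrier V. f (x \<oplus>\<^bsub>V\<^esub> y) z = f x z + f y z) \<and>
     (\<forall>c. \<forall>x\<in>carrier V. \<forall>y\<in>carrier V. f (c \<odot>\<^bsub>V\<^esub> x) y = c * f x y) \<and>
     (\<forall>x\<in>carrier V. \<forall>y\<in>carrier V. f y x = cnj (f x y))"

definition null_vectors :: "(complex, 'a) module \<Rightarrow> ('a \<Rightarrow> 'a \<Rightarrow> complex) \<Rightarrow> 'a set" where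
  "null_vectors V f = {x \<in> carrier V. f x x = 0}"

definition indefinite_inner_product :: "(complex, 'a) module \<Rightarrow> ('a \<Rightarrow> 'a \<Rightarrow> complex) \<Rightarrow> bool" where
  "indefinite_inner_product V f \<longleftrightarrow> inner_product_on V f \<and>
     null_vectors V f \<noteq> {} \<and> \<not> submodule (null_vectors V f) complex_field V"


section \<open>Basic facts\<close>

lemma keys_times_letters:
  assumes "w \<in> Poly_Mapping.keys (a * b :: free)"
  shows "\<exists>u\<in>Poly_Mapping.keys a. \<exists>v\<in>Poly_Mapping.keys b. w = u + v"
  using assms Poly_Mapping.keys_mult[of a b] by blast

lemma ring_free_alg: "ring (free_alg S)"
proof (rule ringI)
  show "abelian_group (free_alg S)"
  proof (rule abelian_groupI)
    fix x assume x: "x \<in> carrier (free_alg S)"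
    show "\<exists>y\<in>carrier (free_alg S). y \<oplus>\<^bsub>free_alg S\<^esub> x = \<zero>\<^bsub>free_alg S\<^esub>"
      using x by (intro bexI[of _ "- x"]) (auto simp: free_alg_def)
  next
    fix x y assume "x \<in> carrier (free_alg S)" "y \<in> carrier (free_alg S)"
    then show "x \<oplus>\<^bsub>free_alg S\<^esub> y \<in> carrier (free_alg S)"
      using Poly_Mapping.keys_add[of x y] by (auto simp: free_alg_def)
  qed (auto simp: free_alg_def add_ac)
  show "Group.monoid (free_alg S)"
  proof (rule monoidI)
    fix x y assume "x \<in> carrier (free_alg S)" "y \<in> carrier (free_alg S)"
    then show "x \<otimes>\<^bsub>free_alg S\<^esub> y \<in> carrier (free_alg S)"
      by (fastforce simp: free_alg_def plus_tl_word_def dest!: keys_times_letters)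
  qed (auto simp: free_alg_def mult.assoc zero_tl_word_def)
qed (auto simp: free_alg_def algebra_simps)

lemma scal_closed: "scal c \<in> carrier (free_alg S)"
  by (auto simp: scal_def free_alg_def zero_tl_word_def)

lemma gen_closed: "k \<in> S \<Longrightarrow> gen k \<in> carrier (free_alg S)"
  by (auto simp: gen_def free_alg_def)

lemma free_alg_diff_closed:
  "a \<in> carrier (free_alg S) \<Longrightarrow> b \<in> carrier (free_alg S) \<Longrightarrow> a - b \<in> carrier (free_alg S)"
  using Poly_Mapping.keys_diff[of a b] by (auto simp: free_alg_def)

lemma free_alg_times_closed:
  "a \<in> carrier (free_alg S) \<Longrightarrow> b \<in> carrier (free_alg S) \<Longrightarrow> a * b \<in> carrier (free_alg S)"
  using monoid.m_closed[OF ring.is_monoid[OF ring_free_alg], of a S b] by (simp add: free_alg_def)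

lemma tl_relations_closed: "tl_relations \<delta> S \<subseteq> carrier (free_alg S)"
  unfolding tl_relations_def
  by (auto intro!: free_alg_diff_closed free_alg_times_closed scal_closed gen_closed)

lemma ideal_tl_ideal: "ideal (tl_ideal \<delta> S) (free_alg S)"
  unfolding tl_ideal_def
  by (rule ring.genideal_ideal[OF ring_free_alg tl_relations_closed])

lemma tl_alg_simps:
  "carrier (tl_alg \<delta> S) = carrier (free_alg S Quot tl_ideal \<delta> S)"
  "mult (tl_alg \<delta> S) = mult (free_alg S Quot tl_ideal \<delta> S)"
  "one (tl_alg \<delta> S) = one (free_alg S Quot tl_ideal \<delta> S)"
  "zero (tl_alg \<delta> S) = zero (free_alg S Quot tl_ideal \<delta> S)"
  "add (tl_alg \<delta> S) = add (free_alg S Quot tl_ideal \<delta> S)"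
  "smult (tl_alg \<delta> S) c X =
     (tl_ideal \<delta> S +>\<^bsub>free_alg S\<^esub> scal c) \<otimes>\<^bsub>free_alg S Quot tl_ideal \<delta> S\<^esub> X"
  by (simp_all add: tl_alg_def ring.defs module.defs)

end

theory Submission
  imports Defs
begin

text \<open>If the null vectors form a subspace, the form is positive semidefinite, because \<open>\<parallel>1\<parallel>\<^sup>2 = 1\<close>; so a null
  vector is orthogonal to everything. Write \<open>[n]\<close> for the quantum integers, so that \<open>[l]\<close> is the first
  one to vanish, and let \<open>p\<^sub>n \<in> TL\<^sub>n\<close>, \<open>n < l\<close>, be the Jones-Wenzl projections. Removing the cup of
  \<open>e\<^sub>n\<close> from link states gives \<open>\<chi>(a e\<^sub>n) = \<gamma> \<delta> \<chi>(a)\<close> for \<open>a \<in> TL\<^sub>n\<^sub>-\<^sub>1\<close>, hence \<open>\<parallel>p\<^sub>n\<parallel>\<^sup>2 = c\<^sub>n\<^sub>,\<^sub>0\<close> and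
  \<open>\<parallel>e\<^sub>n p\<^sub>n\<parallel>\<^sup>2 = \<gamma> \<delta> c\<^sub>n\<^sub>-\<^sub>1\<^sub>,\<^sub>0 [n + 1] / [n]\<close>. Since \<open>e\<^sub>l\<^sub>-\<^sub>1 p\<^sub>l\<^sub>-\<^sub>1\<close> is null, pairing it with \<open>e\<^sub>l\<^sup>2\<close> shows
  \<open>c\<^sub>l\<^sub>-\<^sub>1\<^sub>,\<^sub>0 = 0\<close>. By positivity both \<open>[n + 1]\<close> and \<open>c\<^sub>n\<^sub>,\<^sub>0\<close> are positive for \<open>n < l - 1\<close>; they satisfy
  Chebyshev recurrences with parameters \<open>\<delta>\<close> and \<open>\<gamma>\<^sup>-\<^sup>1\<^sup>/\<^sup>2\<close> and vanish together at \<open>n = l - 1\<close>, which forces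
  \<open>\<gamma> = \<delta>\<^sup>-\<^sup>2\<close>. For \<open>\<delta> = 0\<close> already \<open>e\<^sub>1\<close> is null while \<open>\<chi>(e\<^sub>1 e\<^sub>2) = \<gamma>\<close>.

  That the form is Hermitian comes down to \<open>\<chi>\<close> taking the same value on a word and on its reversal,
  which holds for every trace satisfying the Temperley-Lieb relations.\<close>

section \<open>Reversal of words\<close>

text \<open>The letters of the two words commute pairwise. Positivity is built in because the
  relations of \<open>tl_word_trace\<close> are stated for positive letters.\<close>

definition far :: "nat list \<Rightarrow> nat list \<Rightarrow> bool" where
  "far a b \<longleftrightarrow> (\<forall>i\<in>set a. \<forall>j\<in>set b. 1 \<le> i \<and> 1 \<le> j \<and> (Suc i < j \<or> Suc j < i))"

text \<open>\<open>F\<close> is abstract because the relations serve twice: for the trace on words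
  and for its antisymmetric part under reversal.\<close>

locale tl_word_trace =
  fixes F :: "nat list \<Rightarrow> complex" and d :: complex
  assumes cyc: "F (u @ v) = F (v @ u)"
    and sq: "1 \<le> i \<Longrightarrow> F (u @ [i, i] @ v) = d * F (u @ [i] @ v)"
    and braid: "1 \<le> i \<Longrightarrow> 1 \<le> j \<Longrightarrow> j = Suc i \<or> i = Suc j \<Longrightarrow> F (u @ [i, j, i] @ v) = F (u @ [i] @ v)"
    and comm: "1 \<le> i \<Longrightarrow> 1 \<le> j \<Longrightarrow> Suc i < j \<or> Suc j < i \<Longrightarrow> F (u @ [i, j] @ v) = F (u @ [j, i] @ v)"
begin

lemma comm_letter: "far [i] b \<Longrightarrow> F (u @ [i] @ b @ v) = F (u @ b @ [i] @ v)"
proof (induction b arbitrary: u)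
  case (Cons j b)
  have "F (u @ [i, j] @ (b @ v)) = F (u @ [j, i] @ (b @ v))"
    using Cons.prems by (intro comm) (auto simp: far_def)
  moreover have "F ((u @ [j]) @ [i] @ b @ v) = F ((u @ [j]) @ b @ [i] @ v)"
    using Cons.prems by (intro Cons.IH) (auto simp: far_def)
  ultimately show ?case by simp
qed simp

lemma comm_words: "far a b \<Longrightarrow> F (u @ a @ b @ v) = F (u @ b @ a @ v)"
proof (induction a arbitrary: v rule: rev_induct)
  case (snoc i a)
  have "F ((u @ a) @ [i] @ b @ v) = F ((u @ a) @ b @ [i] @ v)"
    using snoc.prems by (intro comm_letter) (auto simp: far_def)
  moreover have "F (u @ a @ b @ ([i] @ v)) = F (u @ b @ a @ ([i] @ v))"
    using snoc.prems by (intro snoc.IH) (auto simp: far_def)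
  ultimately show ?case by simp
qed simp

text \<open>The hypothesis leaves out the first letter \<open>m\<close> of the string: it has to be handed over to \<open>z\<close> in
  the induction.\<close>

lemma reverse_string:
  assumes "\<And>k i. k \<in> set z \<Longrightarrow> m < i \<Longrightarrow> i < n \<Longrightarrow> 1 \<le> k \<and> (Suc i < k \<or> Suc k < i)"
    and "1 \<le> m"
  shows "F (z @ [m..<n]) = F (z @ rev [m..<n])"
  using assms
proof (induction "n - m" arbitrary: m z)
  case (Suc x)
  then have up: "[m..<n] = m # [Suc m..<n]" by (simp add: upt_conv_Cons)
  have "F ((z @ [m]) @ [Suc m..<n]) = F ((z @ [m]) @ rev [Suc m..<n])"
  proof (rule Suc.hyps(1))
    show "x = n - Suc m" using Suc.hyps(2) by simp
    fix k i assume "k \<in> set (z @ [m])" "Suc m < i" "i < n"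
    then show "1 \<le> k \<and> (Suc i < k \<or> Suc k < i)"
      using Suc.prems(1)[of k i] Suc.prems(2) by auto
  qed simp
  \<comment> \<open>The reversed tail goes cyclically to the front and then commutes past
    \<open>z\<close>, so that \<open>m\<close> comes last, as in \<open>rev [m..<n]\<close>.\<close>
  also have "\<dots> = F (rev [Suc m..<n] @ z @ [m])"
    using cyc[of "z @ [m]"] by simp
  also have "\<dots> = F (z @ rev [Suc m..<n] @ [m])"
  proof -
    have "far (rev [Suc m..<n]) z"
      using Suc.prems by (fastforce simp: far_def)
    from comm_words[OF this, of "[]"] show ?thesis by simp
  qed
  finally show ?case by (simp add: up)
qed simp

text \<open>Two top letters enclose a stretch of smaller letters, in which the induction on
  \<open>m\<close> leaves at most one \<open>m\<close>. Without an \<open>m\<close> the two top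
  letters meet and the square relation merges them; with one \<open>m\<close> the braid relation
  does.\<close>

lemma top_letter_once:
  assumes "set w \<subseteq> {1..m}"
  shows "\<exists>c w'. set w' \<subseteq> {1..m} \<and> count_list w' m \<le> 1 \<and> (\<forall>u v. F (u @ w @ v) = c * F (u @ w' @ v))"
  using assms
proof (induction m arbitrary: w)
  case 0
  then show ?case by (intro exI[of _ 1] exI[of _ "[]"]) auto
next
  case (Suc m)
  from Suc.prems show ?case
  proof (induction w)
    case Nil
    show ?case by (intro exI[of _ 1] exI[of _ "[]"]) auto
  next
    case (Cons k w)
    then obtain c w' where w': "set w' \<subseteq> {1..Suc m}" "count_list w' (Suc m) \<le> 1"
        and red: "\<And>u v. F (u @ w @ v) = c * F (u @ w' @ v)" by auto
    have red': "F (u @ (k # w) @ v) = c * F (u @ (k # w') @ v)" for u v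
      using red[of "u @ [k]" v] by simp
    show ?case
    proof (cases "k = Suc m \<and> Suc m \<in> set w'")
      case False
      then have "count_list (k # w') (Suc m) \<le> 1"
        using w'(2) by (auto simp: count_list_0_iff)
      with red' w'(1) Cons.prems show ?thesis
        by (intro exI[of _ c] exI[of _ "k # w'"]) auto
    next
      case True
      then obtain a b where ab: "w' = a @ Suc m # b" by (auto simp: in_set_conv_decomp)
      then have no: "Suc m \<notin> set a" "Suc m \<notin> set b" using w'(2) by (auto simp: count_list_0_iff)
      have in_a: "set a \<subseteq> {1..m}" and in_b: "set b \<subseteq> {1..m}"
        using w'(1) no by (force simp: ab le_Suc_eq)+
      from Suc.IH[OF in_a] obtain e a' where a': "set a' \<subseteq> {1..m}" "count_list a' m \<le> 1"
          and reda: "\<And>u v. F (u @ a @ v) = e * F (u @ a' @ v)" by blast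
      have no_a': "Suc m \<notin> set a'" using a'(1) by auto
      have reda': "F (u @ (k # w) @ v) = c * e * F (u @ [Suc m] @ a' @ [Suc m] @ b @ v)" for u v
        using red'[of u v] reda[of "u @ [Suc m]" "[Suc m] @ b @ v"] True by (simp add: ab)
      show ?thesis
      proof (cases "m \<in> set a'")
        case False
        then have *: "far [Suc m] a'" using a'(1) by (fastforce simp: far_def le_Suc_eq)
        have "F (u @ (k # w) @ v) = c * e * d * F (u @ (a' @ [Suc m] @ b) @ v)" for u v
          using reda'[of u v] comm_letter[OF *, of u "[Suc m] @ b @ v"]
            sq[of "Suc m" "u @ a'" "b @ v"] by simp
        moreover have "count_list (a' @ [Suc m] @ b) (Suc m) \<le> 1"
          using no no_a' by (simp add: count_list_0_iff[THEN iffD2])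
        ultimately show ?thesis using a'(1) in_b
          by (intro exI[of _ "c * e * d"] exI[of _ "a' @ [Suc m] @ b"]) auto
      next
        case True
        then obtain a1 a2 where aa: "a' = a1 @ m # a2" by (auto simp: in_set_conv_decomp)
        then have "m \<notin> set a1" "m \<notin> set a2" using a'(2) by (auto simp: count_list_0_iff)
        then have "set a1 \<subseteq> {1..<m}" "set a2 \<subseteq> {1..<m}"
          using a'(1) by (force simp: aa le_eq_less_or_eq)+
        then have f1: "far [Suc m] a1" and f2: "far a2 [Suc m]"
          by (fastforce simp: far_def)+
        have m: "1 \<le> m" using True a'(1) by auto
        have "F (u @ (k # w) @ v) = c * e * F (u @ (a1 @ [Suc m] @ a2 @ b) @ v)" for u v
          using reda'[of u v] comm_letter[OF f1, of u "[m] @ a2 @ [Suc m] @ b @ v"]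
            comm_words[OF f2, of "u @ a1 @ [Suc m, m]" "b @ v"]
            braid[of "Suc m" m "u @ a1" "a2 @ b @ v"] m by (simp add: aa)
        moreover have "count_list (a1 @ [Suc m] @ a2 @ b) (Suc m) \<le> 1"
          using no no_a' by (simp add: aa count_list_0_iff[THEN iffD2])
        ultimately show ?thesis using a'(1) in_b
          by (intro exI[of _ "c * e"] exI[of _ "a1 @ [Suc m] @ a2 @ b"]) (auto simp: aa)
      qed
    qed
  qed
qed

text \<open>Moving letters around cyclically and lowering \<open>m\<close>, the word is broken into ascending strings that
  commute with each other. Each string may be reversed inside \<open>F\<close>, so the value of \<open>F\<close> is both
  invariant under reversal of the word and negated by it.\<close>

lemma antisymmetric_zero_aux:
  assumes anti: "\<And>w. F (rev w) = - F w"
    and "set w \<subseteq> {1..<m}" "1 \<le> m" "m \<le> n" "set z \<subseteq> {Suc n..}"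
    and "\<And>u. set u \<subseteq> {1..<n} \<Longrightarrow> F (u @ z) = F (u @ rev z)"
  shows "F (w @ [m..<n] @ z) = 0"
  using assms(2-)
proof (induction m arbitrary: w n z)
  case (Suc m)
  note z = \<open>set z \<subseteq> {Suc n..}\<close> and Rz = Suc.prems(5)
  \<comment> \<open>The current string joins the finished part \<open>z\<close>: its letters are at
    distance at least 2 from those of \<open>z\<close>, so both can be reversed one after the
    other.\<close>
  have R: "F (u @ [Suc m..<n] @ z) = F (u @ rev ([Suc m..<n] @ z))" if u: "set u \<subseteq> {1..<m}" for u
  proof -
    let ?X = "[Suc m..<n]"
    have uz: "far u z" and Xz: "far (rev ?X) z" and Xz': "far (rev ?X) (rev z)"
      using u z Suc.prems(3) by (fastforce simp: far_def)+
    have "F (u @ ?X @ z) = F ((z @ u) @ ?X)"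
      using cyc[of "u @ ?X" z] by simp
    also have "\<dots> = F ((z @ u) @ rev ?X)"
      using u z by (intro reverse_string) fastforce+
    also have "\<dots> = F ((u @ rev ?X) @ z)" using cyc[of z] by simp
    also have "\<dots> = F ((u @ rev ?X) @ rev z)"
      using u Suc.prems(3) by (intro Rz) fastforce
    also have "\<dots> = F (u @ rev z @ rev ?X)"
      using comm_words[OF Xz', of u "[]"] by simp
    finally show ?thesis by simp
  qed
  show ?case
  proof (cases "m = 0")
    case True
    with Suc.prems have "w = []" by simp
    have "F ([Suc m..<n] @ z) = F (rev ([Suc m..<n] @ z))" using R[of "[]"] by simp
    also have "\<dots> = - F ([Suc m..<n] @ z)" by (rule anti)
    finally have "F ([Suc m..<n] @ z) = 0" by simp
    then show ?thesis using \<open>w = []\<close> by simp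
  next
    case False
    have "set w \<subseteq> {1..m}" using Suc.prems(1) by auto
    from top_letter_once[OF this] obtain c w' where w': "set w' \<subseteq> {1..m}" "count_list w' m \<le> 1"
      and red: "\<And>u v. F (u @ w @ v) = c * F (u @ w' @ v)" by blast
    have "F (w' @ [Suc m..<n] @ z) = 0"
    proof (cases "m \<in> set w'")
      \<comment> \<open>The current string ends here and a new one, still empty, starts: the
        induction hypothesis is used with \<open>n = m\<close>.\<close>
      case False
      then have "set w' \<subseteq> {1..<m}" using w'(1) by (force simp: le_eq_less_or_eq)
      moreover have "set ([Suc m..<n] @ z) \<subseteq> {Suc m..}" using z Suc.prems(3) by auto
      ultimately show ?thesis
        using Suc.IH[of w' m "[Suc m..<n] @ z"] R \<open>m \<noteq> 0\<close> by simp
    next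
      case True
      then obtain a b where ab: "w' = a @ m # b" by (auto simp: in_set_conv_decomp)
      then have "m \<notin> set a" "m \<notin> set b" using w'(2) by (auto simp: count_list_0_iff)
      then have sets: "set a \<subseteq> {1..<m}" "set b \<subseteq> {1..<m}"
        using w'(1) by (force simp: ab le_eq_less_or_eq)+
      have far: "far b ([Suc m..<n] @ z)" using sets z Suc.prems(3) by (fastforce simp: far_def)
      have up: "[m..<n] = m # [Suc m..<n]" using Suc.prems(3) by (simp add: upt_conv_Cons)
      \<comment> \<open>The letters \<open>b\<close> behind \<open>m\<close> commute with the
        strings and move cyclically to the front, so \<open>m\<close> extends the string
        downwards.\<close>
      have "F (w' @ [Suc m..<n] @ z) = F ((a @ m # [Suc m..<n] @ z) @ b)"
        using comm_words[OF far, of "a @ [m]" "[]"] by (simp add: ab)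
      also have "\<dots> = F ((b @ a) @ [m..<n] @ z)"
        using cyc[of "a @ m # [Suc m..<n] @ z" b] by (simp add: up)
      also have "\<dots> = 0"
        using sets z Rz \<open>m \<noteq> 0\<close> Suc.prems(3) by (intro Suc.IH) auto
      finally show ?thesis .
    qed
    with red[of "[]"] show ?thesis by simp
  qed
qed simp

end

lemma letters_bounded:
  assumes "0 \<notin> set w"
  obtains n :: nat where "1 \<le> n" "set w \<subseteq> {1..<n}"
proof (rule that[of "Suc (Max (insert 0 (set w)))"])
  show "set w \<subseteq> {1..<Suc (Max (insert 0 (set w)))}"
  proof
    fix k assume k: "k \<in> set w"
    then have "k \<le> Max (insert 0 (set w))" by simp
    moreover have "k \<noteq> 0" using k assms by metis
    ultimately show "k \<in> {1..<Suc (Max (insert 0 (set w)))}" by simp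
  qed
qed simp

text \<open>The relations are symmetric under reversal, so \<open>F w - F (rev w)\<close> satisfies
  them too; as reversal negates it, it vanishes on words of positive letters.\<close>

lemma tl_word_trace_rev:
  assumes "tl_word_trace F d" and "0 \<notin> set w"
  shows "F (rev w) = F w"
proof -
  interpret F: tl_word_trace F d by fact
  interpret G: tl_word_trace "\<lambda>w. F w - F (rev w)" d
  proof
    fix u v :: "nat list" and i j :: nat
    show "F (u @ v) - F (rev (u @ v)) = F (v @ u) - F (rev (v @ u))"
      using F.cyc[of u v] F.cyc[of "rev v" "rev u"] by simp
    show "F (u @ [i, i] @ v) - F (rev (u @ [i, i] @ v)) = d * (F (u @ [i] @ v) - F (rev (u @ [i] @ v)))"
      if "1 \<le> i"
      using F.sq[OF that, of u v] F.sq[OF that, of "rev v" "rev u"] by (simp add: algebra_simps)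
    assume ij: "1 \<le> i" "1 \<le> j"
    show "F (u @ [i, j, i] @ v) - F (rev (u @ [i, j, i] @ v)) = F (u @ [i] @ v) - F (rev (u @ [i] @ v))"
      if "j = Suc i \<or> i = Suc j"
      using F.braid[OF ij that, of u v] F.braid[OF ij that, of "rev v" "rev u"] by simp
    show "F (u @ [i, j] @ v) - F (rev (u @ [i, j] @ v)) = F (u @ [j, i] @ v) - F (rev (u @ [j, i] @ v))"
      if "Suc i < j \<or> Suc j < i"
      using F.comm[OF ij that, of u v] F.comm[OF ij that, of "rev v" "rev u"] by simp
  qed
  obtain n where n: "1 \<le> n" "set w \<subseteq> {1..<n}" using letters_bounded[OF assms(2)] .
  from G.antisymmetric_zero_aux[OF _ n(2,1), of n "[]"]
  show ?thesis by simp
qed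

section \<open>Traces on link states\<close>

definition word_trace :: "complex \<Rightarrow> nat \<Rightarrow> nat \<Rightarrow> nat list \<Rightarrow> complex" where
  "word_trace d n i w = (\<Sum>p\<in>link_states n i. word_matrix d n i w p p)"

lemma link_states_involution: "p \<in> link_states n i \<Longrightarrow> p (p j) = j"
  by (simp add: link_states_def)

lemma link_states_fixed: "p \<in> link_states n i \<Longrightarrow> j \<notin> {1..n} \<Longrightarrow> p j = j"
  by (auto simp: link_states_def)

lemma link_states_planar:
  "p \<in> link_states n i \<Longrightarrow> a < b \<Longrightarrow> b < p a \<Longrightarrow> p b \<noteq> b \<and> a < p b \<and> p b < p a"
  unfolding link_states_def by blast

lemma link_states_range:
  assumes "p \<in> link_states n i" "j \<in> {1..n}" shows "p j \<in> {1..n}"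
  using link_states_fixed[OF assms(1), of "p j"] link_states_involution[OF assms(1), of j] assms(2)
  by metis

lemma finite_link_states: "finite (link_states n i)"
proof (rule finite_imageD)
  \<comment> \<open>The identity outside \<open>{1..n}\<close> is replaced by a constant default
    value, the form in which finiteness of function sets is available.\<close>
  let ?f = "\<lambda>p j. if j \<in> {1..n} then p j else 0 :: nat"
  show "inj_on ?f (link_states n i)"
  proof
    fix p p' assume p: "p \<in> link_states n i" "p' \<in> link_states n i" and eq: "?f p = ?f p'"
    show "p = p'"
    proof
      fix j show "p j = p' j"
        using link_states_fixed[OF p(1), of j] link_states_fixed[OF p(2), of j] fun_cong[OF eq, of j]
        by (cases "j \<in> {1..n}") auto
    qed
  qed
  show "finite (?f ` link_states n i)"
  proof (rule finite_subset)
    show "?f ` link_states n i \<subseteq> {f. \<forall>j. (j \<in> {1..n} \<longrightarrow> f j \<in> {1..n}) \<and> (j \<notin> {1..n} \<longrightarrow> f j = 0)}"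
      using link_states_range by (fastforce split: if_splits)
    show "finite {f. \<forall>j. (j \<in> {1..n} \<longrightarrow> f j \<in> {1..n}) \<and> (j \<notin> {1..n} \<longrightarrow> f j = (0::nat))}"
      by (rule finite_set_of_finite_funs) simp_all
  qed
qed

lemma finite_cups:
  assumes "\<And>j. j \<notin> {1..n} \<Longrightarrow> p j = j" shows "finite {a. a < (p a :: nat)}"
proof (rule finite_subset)
  show "{a. a < p a} \<subseteq> {1..n}" using assms by force
qed simp

section \<open>Removing and inserting a cup on the last two points\<close>

definition strip_cup :: "nat \<Rightarrow> (nat \<Rightarrow> nat) \<Rightarrow> nat \<Rightarrow> nat" where
  "strip_cup n p j = (if j = n \<or> j = Suc n then j else p j)"

definition add_cup :: "nat \<Rightarrow> (nat \<Rightarrow> nat) \<Rightarrow> nat \<Rightarrow> nat" where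
  "add_cup n q j = (if j = n then Suc n else if j = Suc n then n else q j)"

lemma cup_ends:
  assumes "p \<in> link_states m i" "p n = Suc n"
  shows "p j = n \<longleftrightarrow> j = Suc n" "p j = Suc n \<longleftrightarrow> j = n"
  using link_states_involution[OF assms(1)] assms(2) by metis+

lemma add_strip_cup:
  assumes p: "p \<in> link_states m i" "p n = Suc n"
  shows "add_cup n (strip_cup n p) = p"
proof
  fix j show "add_cup n (strip_cup n p) j = p j"
    using p(2) cup_ends[OF p, of j] by (auto simp: add_cup_def strip_cup_def)
qed

lemma strip_add_cup:
  assumes "q \<in> link_states (n - 1) i" "1 \<le> n" shows "strip_cup n (add_cup n q) = q"
proof
  have "q n = n" "q (Suc n) = Suc n" by (rule link_states_fixed[OF assms(1)]; use assms(2) in auto)+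
  then show "strip_cup n (add_cup n q) j = q j" for j by (simp add: add_cup_def strip_cup_def)
qed

text \<open>The cup occupies the last two points, so no other cup passes over it, and turning its
  ends into fixed points keeps the state planar.\<close>

lemma strip_cup_in:
  assumes p: "p \<in> link_states (Suc n) (Suc i)" "p n = Suc n"
  shows "strip_cup n p \<in> link_states (n - 1) i"
proof -
  note ends = cup_ends[OF p]
  have fixed: "strip_cup n p j = j" if "j \<notin> {1..n - 1}" for j
    using that link_states_fixed[OF p(1), of j] by (auto simp: strip_cup_def)
  have inv: "strip_cup n p (strip_cup n p j) = j" for j
    using ends link_states_involution[OF p(1)] by (auto simp: strip_cup_def)
  have planar: "strip_cup n p b \<noteq> b \<and> a < strip_cup n p b \<and> strip_cup n p b < strip_cup n p a"
    if ab: "a < b" "b < strip_cup n p a" for a b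
  proof -
    have pa: "strip_cup n p a = p a" using ab by (auto simp: strip_cup_def split: if_splits)
    then have "a \<in> {1..Suc n}" using link_states_fixed[OF p(1), of a] ab by force
    then have "p a \<le> Suc n" using link_states_range[OF p(1)] by fastforce
    moreover have *: "p b \<noteq> b \<and> a < p b \<and> p b < p a"
      using link_states_planar[OF p(1)] ab pa by simp
    ultimately have "b \<noteq> n" "b \<noteq> Suc n" using p(2) ab pa by auto
    with * pa show ?thesis by (simp add: strip_cup_def)
  qed
  have "{a. a < p a} = insert n {a. a < strip_cup n p a}"
  proof (rule Set.set_eqI)
    fix a
    consider "a = n" | "a = Suc n" | "a \<noteq> n" "a \<noteq> Suc n" by blast
    then show "a \<in> {a. a < p a} \<longleftrightarrow> a \<in> insert n {a. a < strip_cup n p a}"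
      by cases (simp_all add: strip_cup_def p(2) ends(1)[of "Suc n", simplified])
  qed
  moreover have "finite {a. a < strip_cup n p a}" using fixed by (rule finite_cups)
  moreover have "card {a. a < p a} = Suc i" using p(1) by (simp add: link_states_def)
  ultimately have "card {a. a < strip_cup n p a} = i" by (simp add: strip_cup_def)
  with fixed inv planar show ?thesis unfolding link_states_def by blast
qed

lemma add_cup_in:
  assumes q: "q \<in> link_states (n - 1) i" and "1 \<le> n"
  shows "add_cup n q \<in> link_states (Suc n) (Suc i)"
proof -
  have fn: "q n = n" "q (Suc n) = Suc n" by (rule link_states_fixed[OF q]; use \<open>1 \<le> n\<close> in auto)+
  then have ends: "q j = n \<longleftrightarrow> j = n" "q j = Suc n \<longleftrightarrow> j = Suc n" for j
    using link_states_involution[OF q] by metis+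
  have fixed: "add_cup n q j = j" if "j \<notin> {1..Suc n}" for j
    using that link_states_fixed[OF q, of j] \<open>1 \<le> n\<close> by (auto simp: add_cup_def)
  have inv: "add_cup n q (add_cup n q j) = j" for j
    using ends link_states_involution[OF q] by (auto simp: add_cup_def)
  have planar: "add_cup n q b \<noteq> b \<and> a < add_cup n q b \<and> add_cup n q b < add_cup n q a"
    if ab: "a < b" "b < add_cup n q a" for a b
  proof -
    have qa: "add_cup n q a = q a" using ab by (auto simp: add_cup_def split: if_splits)
    then have *: "q b \<noteq> b \<and> a < q b \<and> q b < q a"
      using link_states_planar[OF q] ab by simp
    then have "b \<noteq> n" "b \<noteq> Suc n" using fn by auto
    with * qa show ?thesis by (simp add: add_cup_def)
  qed
  have "{a. a < add_cup n q a} = insert n {a. a < q a}"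
    using fn by (auto simp: add_cup_def)
  moreover have "finite {a. a < q a}"
    using link_states_fixed[OF q] by (rule finite_cups)
  moreover have "card {a. a < q a} = i" using q by (simp add: link_states_def)
  ultimately have "card {a. a < add_cup n q a} = Suc i" using fn by simp
  with fixed inv planar show ?thesis unfolding link_states_def by blast
qed

lemma bij_strip_cup:
  assumes "1 \<le> n"
  shows "bij_betw (strip_cup n) {p \<in> link_states (Suc n) (Suc i). p n = Suc n} (link_states (n - 1) i)"
proof (rule bij_betwI[of _ _ _ "add_cup n"])
  show "strip_cup n \<in> {p \<in> link_states (Suc n) (Suc i). p n = Suc n} \<rightarrow> link_states (n - 1) i"
    using strip_cup_in by blast
  show "add_cup n \<in> link_states (n - 1) i \<rightarrow> {p \<in> link_states (Suc n) (Suc i). p n = Suc n}"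
    using assms by (auto simp: add_cup_in) (simp add: add_cup_def)
qed (use assms in \<open>auto simp: add_strip_cup strip_add_cup\<close>)

lemma join_strip_cup:
  assumes p: "p \<in> link_states m i" "p n = Suc n" and k: "Suc k < n"
  shows "join k p n = Suc n" "join k p (Suc n) = n"
    "join k (strip_cup n p) = strip_cup n (join k p)"
proof -
  have "p (Suc n) = n" using cup_ends(1)[OF p] by simp
  with p(2) k show "join k p n = Suc n" "join k p (Suc n) = n" by (simp_all add: join_def)
  show "join k (strip_cup n p) = strip_cup n (join k p)"
  proof
    fix j
    have "strip_cup n p k = p k" "strip_cup n p (k + 1) = p (k + 1)"
      using k by (simp_all add: strip_cup_def)
    then show "join k (strip_cup n p) j = strip_cup n (join k p) j"
      using k by (cases "j = n \<or> j = Suc n") (auto simp: join_def strip_cup_def)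
  qed
qed

lemma gen_matrix_strip_cup:
  assumes r: "r \<in> link_states (Suc n) (Suc i)" and s: "s \<in> link_states (Suc n) (Suc i)" "s n = Suc n"
    and k: "Suc k < n"
  shows "gen_matrix d k r s =
    (if r n = Suc n then gen_matrix d k (strip_cup n r) (strip_cup n s) else 0)"
proof -
  note j = join_strip_cup[OF s k]
  have "r = join k s \<longleftrightarrow> r n = Suc n \<and> strip_cup n r = join k (strip_cup n s)"
  proof
    assume *: "r n = Suc n \<and> strip_cup n r = join k (strip_cup n s)"
    have "r = add_cup n (strip_cup n r)" using add_strip_cup[OF r conjunct1[OF *]] by (rule sym)
    also have "\<dots> = add_cup n (strip_cup n (join k s))" using * j(3) by simp
    also have "\<dots> = join k s"
      using j by (intro ext) (simp add: add_cup_def strip_cup_def)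
    finally show "r = join k s" .
  qed (simp add: j)
  moreover have "strip_cup n s k = s k" using k by (simp add: strip_cup_def)
  ultimately show ?thesis by (auto simp: gen_matrix_def)
qed

text \<open>Letters below \<open>n - 1\<close> never touch the points \<open>n\<close> and
  \<open>Suc n\<close>. From a state with a cup there only such states are reached, and on them the
  word acts as on \<open>n - 1\<close> points.\<close>

lemma word_matrix_strip_cup:
  assumes "set w \<subseteq> {1..<n - 1}" "r \<in> link_states (Suc n) (Suc i)"
    and p: "p \<in> link_states (Suc n) (Suc i)" "p n = Suc n"
  shows "word_matrix d (Suc n) (Suc i) w r p =
    (if r n = Suc n then word_matrix d (n - 1) i w (strip_cup n r) (strip_cup n p) else 0)"
  using assms(1,2)
proof (induction w arbitrary: r)
  case Nil
  then show ?case
    using p add_strip_cup[OF p] add_strip_cup[OF Nil(2)] by auto metis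
next
  case (Cons k w)
  let ?L = "link_states (Suc n) (Suc i)"
  let ?C = "{s \<in> ?L. s n = Suc n}"
  have k: "Suc k < n" and n: "1 \<le> n" using Cons.prems(1) by auto
  have "word_matrix d (Suc n) (Suc i) (k # w) r p =
      (\<Sum>s\<in>?L. gen_matrix d k r s * word_matrix d (Suc n) (Suc i) w s p)" by simp
  also have "\<dots> = (\<Sum>s\<in>?C. gen_matrix d k r s * word_matrix d (Suc n) (Suc i) w s p)"
    using Cons by (intro sum.mono_neutral_right) (auto simp: finite_link_states)
  also have "\<dots> = (\<Sum>s\<in>?C. if r n = Suc n then gen_matrix d k (strip_cup n r) (strip_cup n s)
      * word_matrix d (n - 1) i w (strip_cup n s) (strip_cup n p) else 0)"
    using Cons k by (intro sum.cong refl) (auto simp: gen_matrix_strip_cup)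
  also have "\<dots> = (if r n = Suc n then \<Sum>s\<in>?C. gen_matrix d k (strip_cup n r) (strip_cup n s)
      * word_matrix d (n - 1) i w (strip_cup n s) (strip_cup n p) else 0)" by simp
  also have "(\<Sum>s\<in>?C. gen_matrix d k (strip_cup n r) (strip_cup n s)
      * word_matrix d (n - 1) i w (strip_cup n s) (strip_cup n p)) =
     (\<Sum>s\<in>link_states (n - 1) i. gen_matrix d k (strip_cup n r) s
      * word_matrix d (n - 1) i w s (strip_cup n p))"
    by (rule sum.reindex_bij_betw[OF bij_strip_cup[OF n]])
  finally show ?case by simp
qed

text \<open>Every state in the image of the generator \<open>n\<close> has the cup at
  \<open>n\<close>, so only such states contribute. The word keeps this cup, and the generator then
  closes one loop, which is the factor \<open>d\<close>.\<close>

lemma word_trace_cup: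
  assumes w: "set w \<subseteq> {1..<n - 1}" and n: "1 \<le> n"
  shows "word_trace d (Suc n) (Suc i) (n # w) = d * word_trace d (n - 1) i w"
proof -
  let ?L = "link_states (Suc n) (Suc i)"
  let ?C = "{s \<in> ?L. s n = Suc n}"
  have join: "join n s = s" if "s \<in> ?C" for s
  proof -
    from that have s: "s \<in> ?L" "s n = Suc n" by auto
    show ?thesis
    proof
      fix j show "join n s j = s j"
        using s(2) cup_ends[OF s, of j] by (auto simp: join_def)
    qed
  qed
  have diag: "(\<Sum>s\<in>?L. gen_matrix d n p s * word_matrix d (Suc n) (Suc i) w s p) =
      d * word_matrix d (n - 1) i w (strip_cup n p) (strip_cup n p)" if p: "p \<in> ?C" for p
  proof -
    have "(\<Sum>s\<in>?L. gen_matrix d n p s * word_matrix d (Suc n) (Suc i) w s p) =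
        (\<Sum>s\<in>{p}. gen_matrix d n p s * word_matrix d (Suc n) (Suc i) w s p)"
    proof (intro sum.mono_neutral_right ballI)
      fix s assume s: "s \<in> ?L - {p}"
      show "gen_matrix d n p s * word_matrix d (Suc n) (Suc i) w s p = 0"
      proof (cases "s n = Suc n")
        case True
        with s join[of s] show ?thesis by (auto simp: gen_matrix_def)
      next
        case False
        with s p word_matrix_strip_cup[OF w, of s i p d] show ?thesis by simp
      qed
    qed (use p in \<open>auto simp: finite_link_states\<close>)
    with p word_matrix_strip_cup[OF w, of p i p d] join[OF p] show ?thesis by (simp add: gen_matrix_def)
  qed
  have "word_trace d (Suc n) (Suc i) (n # w) =
      (\<Sum>p\<in>?L. \<Sum>s\<in>?L. gen_matrix d n p s * word_matrix d (Suc n) (Suc i) w s p)"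
    by (simp add: word_trace_def)
  also have "\<dots> = (\<Sum>p\<in>?C. \<Sum>s\<in>?L. gen_matrix d n p s * word_matrix d (Suc n) (Suc i) w s p)"
  proof (intro sum.mono_neutral_right ballI sum.neutral)
    fix p s assume "p \<in> ?L - ?C" "s \<in> ?L"
    then have "p \<noteq> join n s" by (auto simp: join_def)
    then show "gen_matrix d n p s * word_matrix d (Suc n) (Suc i) w s p = 0"
      by (simp add: gen_matrix_def)
  qed (auto simp: finite_link_states)
  also have "\<dots> = (\<Sum>p\<in>?C. d * word_matrix d (n - 1) i w (strip_cup n p) (strip_cup n p))"
    by (intro sum.cong refl diag)
  also have "\<dots> = (\<Sum>p\<in>link_states (n - 1) i. d * word_matrix d (n - 1) i w p p)"
    by (rule sum.reindex_bij_betw[OF bij_strip_cup[OF n]])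
  finally show ?thesis by (simp add: word_trace_def sum_distrib_left)
qed

lemma word_trace_no_cups: "word_trace d m 0 (n # w) = 0"
  unfolding word_trace_def word_matrix.simps
proof (intro sum.neutral ballI)
  fix p s assume p: "p \<in> link_states m 0"
  have "finite {a. a < p a}" using link_states_fixed[OF p] by (rule finite_cups)
  then have "{a. a < p a} = {}" using p by (simp add: link_states_def)
  then have "\<not> n < p n" by blast
  then have "p \<noteq> join n s" by (auto simp: join_def)
  then show "gen_matrix d n p s * word_matrix d m 0 w s p = 0" by (simp add: gen_matrix_def)
qed

section \<open>The prescribed trace values on words\<close>

definition ext_trace :: "complex \<Rightarrow> real \<Rightarrow> nat \<Rightarrow> nat list \<Rightarrow> complex" where
  "ext_trace d \<gamma> n w = (\<Sum>i\<le>n div 2. complex_of_real (ext_coeff \<gamma> n i) * word_trace d n i w)"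

lemma ext_trace_cup:
  assumes "set w \<subseteq> {1..<n - 1}" "1 \<le> n"
  shows "ext_trace d \<gamma> (Suc n) (n # w) = \<gamma> * d * ext_trace d \<gamma> (n - 1) w"
proof -
  \<comment> \<open>The summand without cups vanishes, and the index shift uses \<open>ext_coeff
    \<gamma> (Suc n) (Suc i) = \<gamma> * ext_coeff \<gamma> (n - 1) i\<close>.\<close>
  have "Suc n div 2 = Suc ((n - 1) div 2)" using \<open>1 \<le> n\<close> by (cases n) auto
  then show ?thesis
    unfolding ext_trace_def
    by (simp add: sum.atMost_Suc_shift word_trace_no_cups word_trace_cup[OF assms] ext_coeff_def
      sum_distrib_left mult_ac del: sum.atMost_Suc)
qed

lemma link_states_no_cups: "link_states n 0 = {id}"
proof safe
  fix p assume p: "p \<in> link_states n 0"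
  have "finite {a. a < p a}" using link_states_fixed[OF p] by (rule finite_cups)
  then have *: "\<not> a < p a" for a using p by (auto simp: link_states_def)
  have "p a = a" for a using *[of a] *[of "p a"] link_states_involution[OF p, of a] by simp
  then show "p = id" by auto
qed (auto simp: link_states_def)

lemma ext_trace_one: "ext_trace d \<gamma> 1 [] = 1"
  by (simp add: ext_trace_def word_trace_def link_states_no_cups ext_coeff_def)

text \<open>This value serves the case \<open>\<delta> = 0\<close>. On three points with one cup,
  the generator 1 takes \<open>P\<close> to \<open>Q\<close> and the generator 2 takes
  \<open>Q\<close> back to \<open>P\<close>, without loops; this is the only diagonal
  contribution.\<close>

lemma ext_trace_21: "ext_trace d \<gamma> 3 [2, 1] = \<gamma>"
proof -
  define P where "P = add_cup 2 id"
  define Q where "Q = add_cup 1 id"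
  have P: "P \<in> link_states 3 1"
    using add_cup_in[of id 2 0] by (simp add: P_def link_states_no_cups numeral_3_eq_3)
  have Q: "Q \<in> link_states 3 1"
  proof -
    have "{a. a < Q a} = {1}" by (auto simp: Q_def add_cup_def)
    then show ?thesis by (auto simp: link_states_def Q_def add_cup_def)
  qed
  have only: "p = P" if "p \<in> link_states 3 1" "p 2 = 3" for p
    using strip_cup_in[of p 2 0] add_strip_cup[of p 3 1 2] that
    by (simp add: P_def link_states_no_cups numeral_3_eq_3)
  have PQ: "join 1 P = Q" "join 2 Q = P" "P 1 = 1" "Q 2 = 1"
    by (auto simp: join_def P_def Q_def add_cup_def fun_eq_iff)
  have one: "word_matrix d 3 1 [1] s P = (if s = Q then 1 else 0)" for s
  proof -
    have "word_matrix d 3 1 [1] s P = (\<Sum>t\<in>{P}. gen_matrix d 1 s t * (if t = P then 1 else 0))"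
      unfolding word_matrix.simps
      using P by (intro sum.mono_neutral_right) (auto simp: finite_link_states)
    then show ?thesis by (simp add: gen_matrix_def PQ del: One_nat_def)
  qed
  have two: "word_matrix d 3 1 [2, 1] P P = 1"
  proof -
    have "word_matrix d 3 1 [2, 1] P P =
        (\<Sum>s\<in>{Q}. gen_matrix d 2 P s * word_matrix d 3 1 [1] s P)"
      unfolding word_matrix.simps(2)[of d 3 1 2]
      using Q by (intro sum.mono_neutral_right) (simp_all add: finite_link_states one del: word_matrix.simps One_nat_def)
    then show ?thesis by (simp add: one gen_matrix_def PQ del: word_matrix.simps One_nat_def)
  qed
  have "word_trace d 3 1 [2, 1] = (\<Sum>p\<in>{P}. word_matrix d 3 1 [2, 1] p p)"
    unfolding word_trace_def
  proof (intro sum.mono_neutral_right ballI)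
    fix p assume "p \<in> link_states 3 1 - {P}"
    then have "p 2 \<noteq> 3" using only by auto
    then have "p \<noteq> join 2 s" for s by (auto simp: join_def)
    then show "word_matrix d 3 1 [2, 1] p p = 0"
      unfolding word_matrix.simps(2)[of d 3 1 2] by (simp add: gen_matrix_def)
  qed (use P in \<open>auto simp: finite_link_states\<close>)
  also have "\<dots> = 1" using two by (simp del: word_matrix.simps)
  finally have "word_trace d 3 1 [2, 1] = 1" .
  then show ?thesis
    unfolding ext_trace_def by (simp add: word_trace_no_cups ext_coeff_def)
qed

section \<open>The free algebra\<close>

lemma free_alg_add_closed:
  "a \<in> carrier (free_alg S) \<Longrightarrow> b \<in> carrier (free_alg S) \<Longrightarrow> a + b \<in> carrier (free_alg S)"
  using Poly_Mapping.keys_add[of a b] by (auto simp: free_alg_def)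

lemma free_carrier_induct [consumes 1, case_names single add]:
  assumes "a \<in> carrier (free_alg S)"
    and single: "\<And>w c. set w \<subseteq> S \<Longrightarrow> P (Poly_Mapping.single (Word w) c)"
    and add: "\<And>a b. a \<in> carrier (free_alg S) \<Longrightarrow> b \<in> carrier (free_alg S) \<Longrightarrow> P a \<Longrightarrow> P b \<Longrightarrow> P (a + b)"
  shows "P a"
proof -
  let ?m = "\<lambda>w. Poly_Mapping.single w (Poly_Mapping.lookup a w)"
  have "sum ?m K \<in> carrier (free_alg S) \<and> P (sum ?m K)" if "finite K" "K \<subseteq> Poly_Mapping.keys a" for K
    using that
  proof (induction K)
    case empty
    show ?case using single[of "[]" 0] by (simp add: free_alg_def)
  next
    case (insert w K)
    then have "set (letters w) \<subseteq> S" using assms(1) by (auto simp: free_alg_def)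
    then have "P (?m w)" "?m w \<in> carrier (free_alg S)"
      using single[of "letters w"] by (auto simp: free_alg_def)
    with insert add[of "?m w" "sum ?m K"] free_alg_add_closed[of "?m w" S "sum ?m K"]
    show ?case by simp
  qed
  then have "P (sum ?m (Poly_Mapping.keys a))" by simp
  moreover have "sum ?m (Poly_Mapping.keys a) = a"
  proof (rule poly_mapping_eqI)
    fix k
    have "(\<Sum>w\<in>Poly_Mapping.keys a. Poly_Mapping.lookup a w when w = k) =
        (\<Sum>w\<in>Poly_Mapping.keys a. if w = k then Poly_Mapping.lookup a w else 0)"
      by (simp only: when_def)
    also have "\<dots> = Poly_Mapping.lookup a k" by (simp add: not_in_keys_iff_lookup_eq_zero)
    finally show "Poly_Mapping.lookup (sum ?m (Poly_Mapping.keys a)) k = Poly_Mapping.lookup a k"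
      by (simp only: lookup_sum lookup_single)
  qed
  ultimately show ?thesis by simp
qed

lemma free_alg_UNIV: "a \<in> carrier (free_alg UNIV)"
  by (simp add: free_alg_def)

lemma free_induct [case_names single add]:
  assumes "\<And>w c. P (Poly_Mapping.single (Word w) c)" "\<And>a b. P a \<Longrightarrow> P b \<Longrightarrow> P (a + b)"
  shows "P (a :: free)"
  using free_alg_UNIV[of a] by (induction rule: free_carrier_induct) (auto intro: assms)

lemma plus_Word [simp]: "Word u + Word v = Word (u @ v)"
  by (simp add: plus_tl_word_def)

lemma scal_mult_commute: "a * scal c = scal c * a"
  by (induction a rule: free_induct)
    (simp_all add: scal_def mult_single zero_tl_word_def algebra_simps)

lemma scal_mult: "scal c * scal d = scal (c * d)"
  by (simp add: scal_def mult_single)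

lemma scal_1: "scal 1 = 1"
  by (simp add: scal_def)

lemma scal_minus: "scal (- c) = - scal c" and scal_diff: "scal (c - d) = scal c - scal d"
  by (simp_all add: scal_def single_uminus single_diff)

section \<open>The involution on the free algebra\<close>

lemma lookup_free_star:
  "Poly_Mapping.lookup (free_star a) w = cnj (Poly_Mapping.lookup a (Word (rev (letters w))))"
proof -
  have "inj (\<lambda>w. Word (rev (letters w)))"
    by (auto intro!: injI simp: tl_word.expand)
  then show ?thesis
    by (simp add: free_star_def map_key.rep_eq map.rep_eq when_def)
qed

lemma free_star_add: "free_star (a + b) = free_star a + free_star b"
  by (rule poly_mapping_eqI) (simp add: lookup_free_star lookup_add)

lemma free_star_diff: "free_star (a - b) = free_star a - free_star b"
  by (rule poly_mapping_eqI) (simp add: lookup_free_star lookup_minus)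

lemma free_star_star: "free_star (free_star a) = a"
  by (rule poly_mapping_eqI) (simp add: lookup_free_star)

lemma free_star_single: "free_star (Poly_Mapping.single (Word w) c) = Poly_Mapping.single (Word (rev w)) (cnj c)"
proof (rule poly_mapping_eqI)
  fix v :: tl_word
  have "Word w = Word (rev (letters v)) \<longleftrightarrow> Word (rev w) = v" by (cases v) auto
  then show "Poly_Mapping.lookup (free_star (Poly_Mapping.single (Word w) c)) v =
      Poly_Mapping.lookup (Poly_Mapping.single (Word (rev w)) (cnj c)) v"
    by (auto simp: lookup_free_star lookup_single when_def)
qed

lemma free_star_mult: "free_star (a * b) = free_star b * free_star a"
proof (induction a rule: free_induct)
  case (single u c)
  show ?case
    by (induction b rule: free_induct)
      (simp_all add: mult_single free_star_single free_star_add algebra_simps)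
qed (simp add: free_star_add algebra_simps)

lemma free_star_scal: "free_star (scal c) = scal (cnj c)"
  by (simp add: scal_def zero_tl_word_def free_star_single)

lemma free_star_gen: "free_star (gen k) = gen k"
  by (simp add: gen_def free_star_single)

lemma free_star_1: "free_star 1 = 1"
  using free_star_scal[of 1] by (simp add: scal_1)

lemma free_star_closed:
  assumes "a \<in> carrier (free_alg S)" shows "free_star a \<in> carrier (free_alg S)"
  using assms
proof (induction rule: free_carrier_induct)
  case (single w c)
  then show ?case by (simp add: free_star_single free_alg_def)
next
  case (add a b)
  then show ?case by (simp add: free_star_add free_alg_add_closed)
qed

lemma free_alg_mono: "S \<subseteq> T \<Longrightarrow> a \<in> carrier (free_alg S) \<Longrightarrow> a \<in> carrier (free_alg T)"
  by (auto simp: free_alg_def)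

section \<open>Linear extension of functions on words\<close>

definition lin :: "(nat list \<Rightarrow> complex) \<Rightarrow> free \<Rightarrow> complex" where
  "lin F a = (\<Sum>w\<in>Poly_Mapping.keys a. Poly_Mapping.lookup a w * F (letters w))"

lemma lin_superset:
  assumes "finite K" "Poly_Mapping.keys a \<subseteq> K"
  shows "lin F a = (\<Sum>w\<in>K. Poly_Mapping.lookup a w * F (letters w))"
  unfolding lin_def using assms by (intro sum.mono_neutral_left) (auto simp: not_in_keys_iff_lookup_eq_zero)

lemma lin_add: "lin F (a + b) = lin F a + lin F b"
proof -
  let ?K = "Poly_Mapping.keys a \<union> Poly_Mapping.keys b"
  have "lin F (a + b) = (\<Sum>w\<in>?K. Poly_Mapping.lookup (a + b) w * F (letters w))"
    by (rule lin_superset) (simp_all add: Poly_Mapping.keys_add)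
  also have "\<dots> = lin F a + lin F b"
    by (simp add: lin_superset[of ?K] lookup_add sum.distrib algebra_simps)
  finally show ?thesis .
qed

lemma lin_single: "lin F (Poly_Mapping.single (Word w) c) = c * F w"
  by (simp add: lin_def)

lemma lin_scal: "lin F (scal c * a) = c * lin F a"
  by (induction a rule: free_induct)
    (simp_all add: scal_def zero_tl_word_def mult_single lin_single lin_add algebra_simps)

section \<open>Jones-Wenzl elements\<close>

text \<open>\<open>quantum_num \<delta> n\<close> is the quantum integer \<open>[n + 1]\<close>, and \<open>jones_wenzl \<delta> n\<close> is the Jones-Wenzl
  element of \<open>TL\<^sub>n\<close>, meaningful only as long as \<open>[1], \<dots>, [n]\<close> do not vanish.\<close>

fun quantum_num :: "real \<Rightarrow> nat \<Rightarrow> real" where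
  "quantum_num \<delta> 0 = 1"
| "quantum_num \<delta> (Suc 0) = \<delta>"
| "quantum_num \<delta> (Suc (Suc n)) = \<delta> * quantum_num \<delta> (Suc n) - quantum_num \<delta> n"

fun jones_wenzl :: "real \<Rightarrow> nat \<Rightarrow> free" where
  "jones_wenzl \<delta> 0 = 1"
| "jones_wenzl \<delta> (Suc 0) = 1"
| "jones_wenzl \<delta> (Suc (Suc n)) = jones_wenzl \<delta> (Suc n)
     - scal (quantum_num \<delta> n / quantum_num \<delta> (Suc n))
       * (jones_wenzl \<delta> (Suc n) * gen (Suc n) * jones_wenzl \<delta> (Suc n))"

text \<open>The trace is pulled back to the free algebra, so that no cosets have to be carried
  along. A context on the right suffices in the relations, by cyclicity. In \<open>L_cup\<close> the
  letters of \<open>a\<close> are at most \<open>n - 2\<close>, whereas the Markov property would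
  also allow \<open>n - 1\<close>.\<close>

locale tl_functional =
  fixes L :: "free \<Rightarrow> complex" and \<delta> \<gamma> :: real
  assumes L_add: "L (a + b) = L a + L b"
    and L_scal: "L (scal c * a) = c * L a"
    and L_commute: "L (a * b) = L (b * a)"
    and L_sq: "1 \<le> i \<Longrightarrow> L (gen i * gen i * x) = \<delta> * L (gen i * x)"
    and L_braid: "1 \<le> i \<Longrightarrow> 1 \<le> j \<Longrightarrow> j = Suc i \<or> i = Suc j \<Longrightarrow> L (gen i * gen j * gen i * x) = L (gen i * x)"
    and L_comm: "1 \<le> i \<Longrightarrow> 1 \<le> j \<Longrightarrow> Suc i < j \<or> Suc j < i \<Longrightarrow> L (gen i * gen j * x) = L (gen j * gen i * x)"
    and L_cup: "1 \<le> n \<Longrightarrow> a \<in> carrier (free_alg {1..<n - 1}) \<Longrightarrow> L (gen n * a) = \<gamma> * \<delta> * L a"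
    and L_one: "L 1 = 1"
    and L_star: "L (free_star a) = cnj (L a)"
begin

abbreviation "s \<equiv> quantum_num \<delta>"
abbreviation "p \<equiv> jones_wenzl \<delta>"

text \<open>Equality modulo the radical of the trace: all identities between Jones-Wenzl elements are only
  needed in this quotient.\<close>

definition eqv :: "free \<Rightarrow> free \<Rightarrow> bool" (infix "\<approx>" 50) where
  "a \<approx> b \<longleftrightarrow> (\<forall>x. L (a * x) = L (b * x))"

lemma L_minus: "L (- a) = - L a"
  using L_scal[of "-1" a] by (simp add: scal_minus scal_1)

lemma L_diff: "L (a - b) = L a - L b"
  using L_add[of a "- b"] by (simp add: L_minus)

lemma eqv_refl [simp, intro]: "a \<approx> a" by (simp add: eqv_def)

lemma eqv_sym: "a \<approx> b \<Longrightarrow> b \<approx> a" by (simp add: eqv_def)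

lemma eqv_trans [trans]: "a \<approx> b \<Longrightarrow> b \<approx> c \<Longrightarrow> a \<approx> c" by (simp add: eqv_def)

lemma eqv_eq_trans [trans]: "a \<approx> b \<Longrightarrow> b = c \<Longrightarrow> a \<approx> c" "a = b \<Longrightarrow> b \<approx> c \<Longrightarrow> a \<approx> c" by simp_all

lemma eqv_diff: "a \<approx> b \<Longrightarrow> c \<approx> d \<Longrightarrow> a - c \<approx> b - d"
  by (simp add: eqv_def left_diff_distrib L_diff)

text \<open>The radical of a trace is a two-sided ideal: cyclicity carries the left factor around to
  the other side of the test element.\<close>

lemma eqv_mult: assumes "a \<approx> b" "c \<approx> d" shows "a * c \<approx> b * d"
  unfolding eqv_def
proof
  fix x
  have "L (a * c * x) = L (b * c * x)" using assms(1) by (simp add: eqv_def mult.assoc)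
  also have "\<dots> = L (c * (x * b))" using L_commute[of b "c * x"] by (simp add: mult.assoc)
  also have "\<dots> = L (d * (x * b))" using assms(2) by (simp add: eqv_def)
  also have "\<dots> = L (b * d * x)" using L_commute[of b "d * x"] by (simp add: mult.assoc)
  finally show "L (a * c * x) = L (b * d * x)" .
qed

lemma eqv_mult_left: "c \<approx> d \<Longrightarrow> a * c \<approx> a * d" by (intro eqv_mult eqv_refl)

lemma eqv_mult_right: "a \<approx> b \<Longrightarrow> a * c \<approx> b * c" by (intro eqv_mult eqv_refl)

lemma eqv_L: "a \<approx> b \<Longrightarrow> L a = L b"
  unfolding eqv_def by (metis mult.right_neutral)

lemma eqv_star: assumes "a \<approx> b" shows "free_star a \<approx> free_star b"
  unfolding eqv_def
proof
  fix x
  have "L (free_star a * x) = cnj (L (free_star x * a))"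
    using L_star[of "free_star x * a"] by (simp add: free_star_mult free_star_star)
  also have "L (free_star x * a) = L (free_star x * b)"
    using assms L_commute[of "free_star x"] by (simp add: eqv_def)
  also have "cnj (L (free_star x * b)) = L (free_star b * x)"
    using L_star[of "free_star x * b"] by (simp add: free_star_mult free_star_star)
  finally show "L (free_star a * x) = L (free_star b * x)" .
qed

lemma gen_sq: "1 \<le> i \<Longrightarrow> gen i * gen i \<approx> scal \<delta> * gen i"
  by (simp add: eqv_def L_sq L_scal mult.assoc del: One_nat_def) (simp add: L_sq flip: mult.assoc)

lemma gen_braid: "1 \<le> i \<Longrightarrow> 1 \<le> j \<Longrightarrow> j = Suc i \<or> i = Suc j \<Longrightarrow> gen i * gen j * gen i \<approx> gen i"
  unfolding eqv_def using L_braid by blast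

lemma gen_comm: "1 \<le> i \<Longrightarrow> 1 \<le> j \<Longrightarrow> Suc i < j \<or> Suc j < i \<Longrightarrow> gen i * gen j \<approx> gen j * gen i"
  unfolding eqv_def using L_comm by blast

section \<open>Wenzl's recursion modulo the radical\<close>

lemma star_p: "free_star (p n) = p n"
  by (induction \<delta> n rule: jones_wenzl.induct)
    (simp_all add: free_star_1 free_star_diff free_star_mult free_star_scal free_star_gen
      scal_mult_commute mult.assoc)

lemma p_closed: "p n \<in> carrier (free_alg {1..<n})"
proof (induction n rule: induct_nat_012)
  case (ge2 n)
  let ?A = "carrier (free_alg {1..<Suc (Suc n)})"
  have "p (Suc n) \<in> ?A" using ge2 by (auto intro: free_alg_mono[rotated])
  moreover have "gen (Suc n) \<in> ?A" by (auto intro: gen_closed)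
  ultimately show ?case
    by (auto intro!: free_alg_diff_closed free_alg_times_closed scal_closed)
qed (simp_all add: free_alg_def zero_tl_word_def)

lemma p_gen_commute: "n < k \<Longrightarrow> p n * gen k \<approx> gen k * p n"
proof (induction n arbitrary: k rule: induct_nat_012)
  case (ge2 n)
  let ?p = "p (Suc n)" and ?g = "gen (Suc n)"
  have pk: "?p * gen k \<approx> gen k * ?p" using ge2 by simp
  have gk: "?g * gen k \<approx> gen k * ?g" using ge2.prems by (intro gen_comm) auto
  have "?p * ?g * ?p * gen k = ?p * ?g * (?p * gen k)" by (simp add: mult.assoc)
  also have "\<dots> \<approx> ?p * ?g * (gen k * ?p)" by (intro eqv_mult_left pk)
  also have "\<dots> = ?p * (?g * gen k) * ?p" by (simp add: mult.assoc)
  also have "\<dots> \<approx> ?p * (gen k * ?g) * ?p" by (intro eqv_mult_left eqv_mult_right gk)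
  also have "\<dots> = ?p * gen k * (?g * ?p)" by (simp add: mult.assoc)
  also have "\<dots> \<approx> gen k * ?p * (?g * ?p)" by (intro eqv_mult_right pk)
  also have "\<dots> = gen k * (?p * ?g * ?p)" by (simp add: mult.assoc)
  finally have q: "?p * ?g * ?p * gen k \<approx> gen k * (?p * ?g * ?p)" .
  define c where "c = scal (complex_of_real (s n / s (Suc n)))"
  have "(?p - c * (?p * ?g * ?p)) * gen k = ?p * gen k - c * (?p * ?g * ?p * gen k)"
    by (simp add: algebra_simps)
  also have "\<dots> \<approx> gen k * ?p - c * (gen k * (?p * ?g * ?p))"
    by (intro eqv_diff eqv_mult_left pk q)
  also have "\<dots> = gen k * (?p - c * (?p * ?g * ?p))"
    using scal_mult_commute[of "gen k"] by (simp add: right_diff_distrib c_def flip: mult.assoc)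
  finally show ?case by (simp add: c_def)
qed simp_all

text \<open>Wenzl's induction. The identities are proved together because idempotence of the next
  element uses the third identity for the current one. The assumption keeps all denominators in
  \<open>p (Suc n)\<close> nonzero.\<close>

lemma jones_wenzl_props:
  assumes "\<And>i. i \<le> n \<Longrightarrow> s i \<noteq> 0"
  shows "p (Suc n) * p (Suc n) \<approx> p (Suc n)"
    and "p n * p (Suc n) \<approx> p (Suc n)"
    and "gen (Suc n) * p (Suc n) * gen (Suc n) \<approx> scal (s (Suc n) / s n) * (p n * gen (Suc n))"
proof -
  have "p (Suc n) * p (Suc n) \<approx> p (Suc n) \<and> p n * p (Suc n) \<approx> p (Suc n)
     \<and> gen (Suc n) * p (Suc n) * gen (Suc n) \<approx> scal (s (Suc n) / s n) * (p n * gen (Suc n))"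
    using assms
  proof (induction n)
    case 0
    show ?case using gen_sq[of 1] by simp
  next
    case (Suc n)
    define P where "P = p (Suc n)"
    define g where "g = gen (Suc n)"
    define h where "h = gen (Suc (Suc n))"
    define Q where "Q = P * g * P"
    define c where "c = scal (complex_of_real (s n / s (Suc n)))"
    define t where "t = scal (complex_of_real (s (Suc n) / s n))"
    define R where "R = p (Suc (Suc n))"
    have R: "R = P - c * Q" by (simp add: R_def P_def c_def Q_def g_def)
    have IH: "P * P \<approx> P" "p n * P \<approx> P" "g * P * g \<approx> t * (p n * g)"
      using Suc by (simp_all add: P_def g_def t_def)
    have "s n \<noteq> 0" "s (Suc n) \<noteq> 0" using Suc.prems by auto
    then have "complex_of_real (s n / s (Suc n)) * complex_of_real (s (Suc n) / s n) = 1"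
      by simp
    \<comment> \<open>\<open>c\<close> is the coefficient in the recursion and \<open>t\<close> the
      one in the third identity; being inverse to each other, they make \<open>R * R\<close>
      collapse to \<open>R\<close>.\<close>
    then have ct: "c * t = 1" by (simp only: c_def t_def scal_mult scal_1)
    have c: "a * c = c * a" and t: "a * t = t * a" for a by (simp_all only: c_def t_def scal_mult_commute)
    have PpP: "P * p n \<approx> P"
      using eqv_star[OF IH(2)] by (simp add: P_def free_star_mult star_p)
    have gp: "p n * g \<approx> g * p n" by (simp add: g_def p_gen_commute)
    have Ph: "P * h \<approx> h * P" by (simp add: P_def h_def p_gen_commute)
    have PQ: "P * Q \<approx> Q"
      using eqv_mult_right[OF IH(1), of "g * P"] by (simp add: Q_def mult.assoc)
    have QP: "Q * P \<approx> Q"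
      using eqv_mult_left[OF IH(1), of "P * g"] by (simp add: Q_def mult.assoc)
    have "Q * Q = P * g * (P * P) * g * P" by (simp add: Q_def mult.assoc)
    also have "\<dots> \<approx> P * g * P * g * P" by (intro eqv_mult_right eqv_mult_left IH)
    also have "\<dots> = P * (g * P * g) * P" by (simp add: mult.assoc)
    also have "\<dots> \<approx> P * (t * (p n * g)) * P" by (intro eqv_mult_right eqv_mult_left IH)
    also have "\<dots> = t * ((P * p n) * (g * P))" using t[of P] by (simp flip: mult.assoc)
    also have "\<dots> \<approx> t * (P * (g * P))" by (intro eqv_mult_right eqv_mult_left PpP)
    finally have QQ: "Q * Q \<approx> t * Q" by (simp add: Q_def mult.assoc)
    have "R * R = P * P - c * (P * Q) - c * (Q * P) + c * (c * (Q * Q))"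
      using c[of P] c[of Q] by (simp add: R algebra_simps) (simp flip: mult.assoc)
    also have "\<dots> = P * P - c * (P * Q) - (c * (Q * P) - c * (c * (Q * Q)))" by simp
    also have "\<dots> \<approx> P - c * Q - (c * Q - c * (c * (t * Q)))"
      by (intro eqv_diff eqv_mult_left IH PQ QP QQ)
    also have "c * (c * (t * Q)) = c * ((c * t) * Q)" by (simp add: mult.assoc)
    also have "P - c * Q - (c * Q - c * ((c * t) * Q)) = R" by (simp add: ct R)
    finally have RR: "R * R \<approx> R" .
    have "P * R = P * P - c * (P * Q)" using c[of P] by (simp add: R right_diff_distrib flip: mult.assoc)
    also have "\<dots> \<approx> P - c * Q" by (intro eqv_diff eqv_mult_left IH PQ)
    finally have PR: "P * R \<approx> R" by (simp add: R)
    have hgh: "h * g * h \<approx> h" by (simp add: h_def g_def gen_braid)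
    have hPh: "h * P * h \<approx> scal \<delta> * (P * h)"
    proof -
      have "h * P * h \<approx> P * h * h" by (intro eqv_mult_right eqv_sym[OF Ph])
      also have "\<dots> = P * (h * h)" by (simp add: mult.assoc)
      also have "\<dots> \<approx> P * (scal \<delta> * h)" unfolding h_def by (intro eqv_mult_left gen_sq) simp
      also have "\<dots> = scal \<delta> * (P * h)" using scal_mult_commute[of P] by (simp flip: mult.assoc)
      finally show ?thesis .
    qed
    \<comment> \<open>\<open>P\<close> commutes with \<open>h\<close>, so both \<open>h\<close> can
      be brought next to \<open>g\<close>, where the braid relation applies.\<close>
    have "h * Q * h = (h * P) * g * (P * h)" by (simp add: Q_def mult.assoc)
    also have "\<dots> \<approx> (P * h) * g * (h * P)"
      by (intro eqv_mult eqv_refl Ph eqv_sym[OF Ph])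
    also have "\<dots> = P * (h * g * h) * P" by (simp add: mult.assoc)
    also have "\<dots> \<approx> P * h * P" by (intro eqv_mult_right eqv_mult_left hgh)
    also have "\<dots> = P * (h * P)" by (simp add: mult.assoc)
    also have "\<dots> \<approx> P * (P * h)" by (intro eqv_mult_left eqv_sym[OF Ph])
    also have "\<dots> = P * P * h" by (simp add: mult.assoc)
    also have "\<dots> \<approx> P * h" by (intro eqv_mult_right IH)
    finally have hQh: "h * Q * h \<approx> P * h" .
    have "h * R * h = h * P * h - c * (h * Q * h)"
      using c[of h] by (simp add: R left_diff_distrib right_diff_distrib flip: mult.assoc)
    also have "\<dots> \<approx> scal \<delta> * (P * h) - c * (P * h)" by (intro eqv_diff eqv_mult_left hPh hQh)
    also have "\<dots> = scal (\<delta> - complex_of_real (s n / s (Suc n))) * (P * h)"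
      by (simp add: c_def scal_diff left_diff_distrib)
    also have "\<delta> - complex_of_real (s n / s (Suc n)) = complex_of_real (s (Suc (Suc n)) / s (Suc n))"
      using \<open>s (Suc n) \<noteq> 0\<close> by (simp add: field_simps)
    finally have hRh: "h * R * h \<approx> scal (s (Suc (Suc n)) / s (Suc n)) * (P * h)" .
    show ?case using RR PR hRh unfolding R_def P_def h_def by blast
  qed
  then show "p (Suc n) * p (Suc n) \<approx> p (Suc n)" "p n * p (Suc n) \<approx> p (Suc n)"
    "gen (Suc n) * p (Suc n) * gen (Suc n) \<approx> scal (s (Suc n) / s n) * (p n * gen (Suc n))" by blast+
qed

lemma L_gen_p_gen:
  assumes "\<And>i. i \<le> n \<Longrightarrow> s i \<noteq> 0"
  shows "L (gen (Suc n) * p (Suc n) * gen (Suc n)) = s (Suc n) / s n * \<gamma> * \<delta> * L (p n)"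
proof -
  have "L (gen (Suc n) * p (Suc n) * gen (Suc n)) = s (Suc n) / s n * L (p n * gen (Suc n))"
    using eqv_L[OF jones_wenzl_props(3)[OF assms]] by (simp add: L_scal)
  also have "L (p n * gen (Suc n)) = L (gen (Suc n) * p n)" by (rule L_commute)
  also have "\<dots> = \<gamma> * \<delta> * L (p n)" using p_closed[of n] by (intro L_cup) auto
  finally show ?thesis by simp
qed

text \<open>The traces follow the recursion of \<open>ext_coeff0\<close>: the quotient of quantum
  numbers from \<open>L_gen_p_gen\<close> cancels the coefficient in the definition of
  \<open>p\<close>.\<close>

lemma L_p:
  assumes "\<delta> \<noteq> 0" "\<And>i. i < n \<Longrightarrow> s i \<noteq> 0"
  shows "L (p n) = ext_coeff0 \<gamma> n"
  using assms(2)
proof (induction n rule: induct_nat_012)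
  case (ge2 n)
  let ?p = "p (Suc n)" and ?g = "gen (Suc n)"
  have nz: "s i \<noteq> 0" if "i \<le> n" for i using ge2.prems[of i] that by simp
  have "s (Suc n) \<noteq> 0" "s n \<noteq> 0" using ge2.prems by auto
  have "L (?p * ?g * ?p) = L (?p * ?p * ?g)"
    using L_commute[of "?p * ?g" ?p] by (simp add: mult.assoc)
  also have "\<dots> = L (?p * ?g)" by (intro eqv_L eqv_mult_right jones_wenzl_props(1) nz)
  finally have pgp: "L (?p * ?g * ?p) = L (?p * ?g)" .
  \<comment> \<open>\<open>?p\<close> may contain the letter \<open>n\<close>, which
    \<open>L_cup\<close> excludes here. Doubling the generator costs a factor
    \<open>\<delta>\<close> and yields the compression \<open>?g * ?p * ?g\<close>, whose trace is
    known; \<open>\<delta>\<close> is cancelled afterwards.\<close>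
  have "\<delta> * L (?p * ?g) = L (?g * ?g * ?p)" using L_sq[of "Suc n" ?p] L_commute[of ?p ?g] by simp
  also have "\<dots> = L (?g * ?p * ?g)" using L_commute[of ?g "?g * ?p"] by (simp add: mult.assoc)
  also have "\<dots> = s (Suc n) / s n * \<gamma> * \<delta> * L (p n)" by (rule L_gen_p_gen[OF nz])
  finally have "\<delta> * L (?p * ?g) = \<delta> * (s (Suc n) / s n * \<gamma> * L (p n))" by simp
  then have "L (?p * ?g) = s (Suc n) / s n * \<gamma> * L (p n)"
    using \<open>\<delta> \<noteq> 0\<close> by (simp only: mult_left_cancel of_real_eq_0_iff simp_thms)
  then show ?case
    using ge2 \<open>s (Suc n) \<noteq> 0\<close> \<open>s n \<noteq> 0\<close> by (simp add: L_diff L_scal pgp)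
qed (simp_all add: L_one)

section \<open>Consequences of positive semidefiniteness\<close>

definition psd :: bool where
  "psd \<longleftrightarrow> (\<forall>a\<in>carrier (free_alg {1..}). 0 \<le> Re (L (a * free_star a)))"

text \<open>The Cauchy-Schwarz argument: otherwise adding a suitable multiple of the null vector
  \<open>a\<close> to \<open>free_star b\<close> would make the squared norm negative.\<close>

lemma psd_null:
  assumes psd and a: "a \<in> carrier (free_alg {1..})" "L (a * free_star a) = 0"
    and b: "b \<in> carrier (free_alg {1..})"
  shows "L (a * b) = 0"
proof (rule ccontr)
  assume nz: "L (a * b) \<noteq> 0"
  define z where "z = L (a * b)"
  \<comment> \<open>The squared norm of \<open>y\<close> is that of \<open>free_star b\<close> plus
    \<open>2 * Re (t * z)\<close>. The choice of \<open>t\<close> makes \<open>t * z\<close> real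
    and negative up to the sign of \<open>k\<close>, and \<open>k\<close> makes the total equal to
    -1.\<close>
  define k where "k = (Re (L (free_star b * b)) + 1) / (2 * (cmod z)\<^sup>2)"
  define t where "t = - (of_real k * cnj z)"
  define y where "y = free_star b + scal t * a"
  have y: "y \<in> carrier (free_alg {1..})"
    unfolding y_def by (intro free_alg_add_closed free_alg_times_closed free_star_closed scal_closed a b)
  have "free_star y = b + free_star a * scal (cnj t)"
    by (simp add: y_def free_star_add free_star_star free_star_mult free_star_scal)
  also have "\<dots> = b + scal (cnj t) * free_star a" by (simp add: scal_mult_commute)
  finally have "y * free_star y = free_star b * b + free_star b * (scal (cnj t) * free_star a)
      + scal t * (a * b) + scal t * (a * (scal (cnj t) * free_star a))"
    by (simp add: y_def algebra_simps)
  also have "a * (scal (cnj t) * free_star a) = scal (cnj t) * (a * free_star a)"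
    using scal_mult_commute[of a] by (simp flip: mult.assoc)
  also have "free_star b * (scal (cnj t) * free_star a) = scal (cnj t) * free_star (a * b)"
    using scal_mult_commute[of "free_star b"] by (simp add: free_star_mult flip: mult.assoc)
  finally have "L (y * free_star y) = L (free_star b * b) + cnj (t * z) + t * z"
    using a(2) by (simp add: L_add L_scal L_star z_def)
  then have "Re (L (y * free_star y)) = Re (L (free_star b * b)) + 2 * Re (t * z)" by simp
  also have "t * z = of_real (- k * (cmod z)\<^sup>2)"
    by (simp add: t_def mult.assoc complex_norm_square[symmetric] mult.commute[of "cnj z"])
  also have "Re (of_real (- k * (cmod z)\<^sup>2)) = - k * (cmod z)\<^sup>2" by simp
  finally have "Re (L (y * free_star y)) = Re (L (free_star b * b)) + 2 * (- k * (cmod z)\<^sup>2)" .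
  moreover have "k * (cmod z)\<^sup>2 = (Re (L (free_star b * b)) + 1) / 2"
    using nz by (simp add: k_def z_def)
  ultimately have "Re (L (y * free_star y)) = -1" by (simp add: field_simps)
  with \<open>psd\<close> y show False by (fastforce simp: psd_def)
qed

text \<open>Up to \<open>N\<close>, signs come from squared norms: \<open>p n\<close> has squared
  norm \<open>ext_coeff0 \<gamma> n\<close>, and that of \<open>gen (Suc n) * p (Suc n)\<close>
  carries the factor \<open>s (Suc n) / s n\<close>. The latter vector becomes null when
  \<open>Suc n = N\<close>.\<close>

lemma psd_quantum_num:
  assumes psd and "\<delta> > 0" "\<gamma> > 0" "2 \<le> N" "s N = 0" and nz: "\<And>i. i < N \<Longrightarrow> s i \<noteq> 0"
  shows "ext_coeff0 \<gamma> N = 0" "\<And>n. n < N \<Longrightarrow> 0 < ext_coeff0 \<gamma> n \<and> 0 < s n"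
proof -
  let ?c = "ext_coeff0 \<gamma>" and ?A = "carrier (free_alg {1..})"
  have Lp: "L (p n) = ?c n" if "n \<le> N" for n
    using that \<open>\<delta> > 0\<close> nz by (intro L_p) auto
  have pA: "p n \<in> ?A" for n by (rule free_alg_mono[OF _ p_closed]) auto
  have gA: "gen (Suc n) \<in> ?A" for n by (intro gen_closed) auto
  have "0 \<le> ?c (Suc n)" if "Suc n \<le> N" for n
  proof -
    have "L (p (Suc n) * free_star (p (Suc n))) = L (p (Suc n))"
      unfolding star_p using nz that by (intro eqv_L jones_wenzl_props(1)) auto
    then show ?thesis using \<open>psd\<close> pA[of "Suc n"] Lp[OF that] by (auto simp: psd_def)
  qed
  then have c0: "0 \<le> ?c n" if "n \<le> N" for n using that by (cases n) auto
  have gpg: "L (gen (Suc n) * p (Suc n) * free_star (gen (Suc n) * p (Suc n)))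
      = s (Suc n) / s n * \<gamma> * \<delta> * ?c n" if "Suc n \<le> N" for n
  proof -
    have "gen (Suc n) * p (Suc n) * free_star (gen (Suc n) * p (Suc n))
        = gen (Suc n) * (p (Suc n) * p (Suc n)) * gen (Suc n)"
      by (simp add: free_star_mult star_p free_star_gen mult.assoc)
    also have "L \<dots> = L (gen (Suc n) * p (Suc n) * gen (Suc n))"
      using nz that by (intro eqv_L eqv_mult_right eqv_mult_left jones_wenzl_props(1)) auto
    also have "\<dots> = s (Suc n) / s n * \<gamma> * \<delta> * L (p n)" using nz that by (intro L_gen_p_gen) auto
    finally show ?thesis using Lp[of n] that by simp
  qed
  have cpos: "0 < ?c n" if "n < N" for n
    using that
  proof (induction n rule: induct_nat_012)
    case (ge2 n)
    show ?case
    proof (rule ccontr)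
      assume "\<not> 0 < ?c (Suc (Suc n))"
      then have "?c (Suc (Suc n)) = 0" using c0[of "Suc (Suc n)"] ge2.prems by simp
      \<comment> \<open>A zero would be followed by a negative value, whose index is still at most
        \<open>N\<close>, where nonnegativity is known.\<close>
      then have "?c (Suc (Suc (Suc n))) = - \<gamma> * ?c (Suc n)" by (subst ext_coeff0.simps) simp
      also have "\<dots> < 0" using ge2 \<open>\<gamma> > 0\<close> by simp
      finally show False using c0[of "Suc (Suc (Suc n))"] ge2.prems by simp
    qed
  qed simp_all
  have spos: "0 < s n" if "n < N" for n
    using that
  proof (induction n)
    case (Suc n)
    have "gen (Suc n) * p (Suc n) \<in> ?A" by (intro free_alg_times_closed gA pA)
    then have "0 \<le> Re (L (gen (Suc n) * p (Suc n) * free_star (gen (Suc n) * p (Suc n))))"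
      using \<open>psd\<close> by (auto simp: psd_def)
    also have "\<dots> = s (Suc n) / s n * \<gamma> * \<delta> * ?c n" using gpg[of n] Suc.prems by simp
    finally have nonneg: "0 \<le> (\<gamma> * \<delta> * ?c n / s n) * s (Suc n)" by (simp add: mult_ac)
    have "0 < \<gamma> * \<delta> * ?c n / s n" using Suc cpos[of n] \<open>\<delta> > 0\<close> \<open>\<gamma> > 0\<close> by simp
    then have "0 \<le> s (Suc n)" using nonneg mult_pos_neg not_less by blast
    with nz[of "Suc n"] Suc.prems show ?case by simp
  qed simp
  show "0 < ?c n \<and> 0 < s n" if "n < N" for n using cpos spos that by blast
  obtain n where N: "N = Suc n" using \<open>2 \<le> N\<close> by (cases N) auto
  let ?h = "gen (Suc (Suc n))" and ?g = "gen (Suc n)" and ?p = "p (Suc n)"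
  \<comment> \<open>The null vector pairs to 0 with \<open>?h * ?h\<close>. One \<open>?h\<close>
    commutes past \<open>?p\<close>, the other comes around cyclically, and the braid relation turns
    \<open>?h * ?g * ?h\<close> into \<open>?h\<close>, which leaves a multiple of
    \<open>L ?p\<close>.\<close>
  have "L (?g * ?p * (?h * ?h)) = 0"
    by (rule psd_null[OF \<open>psd\<close> free_alg_times_closed[OF gA pA] _ free_alg_times_closed[OF gA gA]])
      (use gpg[of n] \<open>s N = 0\<close> N in simp)
  also have "?g * ?p * (?h * ?h) = ?g * (?p * ?h * ?h)" by (simp add: mult.assoc)
  also have "L \<dots> = L (?g * (?h * ?p * ?h))"
    by (intro eqv_L eqv_mult_left eqv_mult_right p_gen_commute) simp
  also have "\<dots> = L (?h * ?g * ?h * ?p)"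
    using L_commute[of "?g * ?h * ?p" ?h] by (simp add: mult.assoc)
  also have "\<dots> = L (?h * ?p)" by (intro L_braid) auto
  also have "\<dots> = \<gamma> * \<delta> * L ?p" using p_closed[of "Suc n"] by (intro L_cup) auto
  finally show "?c N = 0" using Lp[of N] N \<open>\<delta> > 0\<close> \<open>\<gamma> > 0\<close> by simp
qed

text \<open>The coefficients \<open>c\<^sub>n\<close> are, up to powers of \<open>r = \<surd>\<gamma>\<close>, the quantum numbers of the parameter
  \<open>1 / r\<close>. Two positive solutions that vanish at the same place belong to the same parameter, by the
  discrete Wronskian.\<close>

lemma psd_imp_markov:
  assumes psd and "\<delta> > 0" "\<gamma> > 0" "2 \<le> N" "s N = 0" and nz: "\<And>i. i < N \<Longrightarrow> s i \<noteq> 0"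
  shows "\<gamma> = 1 / \<delta>\<^sup>2"
proof -
  define r where "r = sqrt \<gamma>"
  have r: "r > 0" "\<gamma> = r\<^sup>2" using \<open>\<gamma> > 0\<close> by (simp_all add: r_def)
  define u where "u n = ext_coeff0 \<gamma> n / r ^ n" for n
  have u_rec: "u (Suc (Suc n)) = u (Suc n) / r - u n" for n
    using r by (simp add: u_def field_simps power2_eq_square)
  have wronskian: "u (Suc n) * s n - u n * s (Suc n) = (1 / r - \<delta>) * (\<Sum>i\<le>n. u i * s i)" for n
  proof (induction n)
    case 0
    show ?case by (simp add: u_def)
  next
    case (Suc n)
    have "u (Suc (Suc n)) * s (Suc n) - u (Suc n) * s (Suc (Suc n))
        = (1 / r - \<delta>) * (u (Suc n) * s (Suc n)) + (u (Suc n) * s n - u n * s (Suc n))"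
      by (simp add: u_rec algebra_simps)
    with Suc show ?case by (simp add: algebra_simps)
  qed
  note pos = psd_quantum_num[OF assms]
  obtain n where N: "N = Suc n" using \<open>2 \<le> N\<close> by (cases N) auto
  \<comment> \<open>Both sequences are positive below \<open>N\<close> and vanish at
    \<open>N\<close>, so the Wronskian is 0 while the sum is not; its factor must vanish.\<close>
  have "(\<Sum>i\<le>n. u i * s i) > 0"
    using pos(2) r by (intro sum_pos) (auto simp: N u_def)
  moreover have "(1 / r - \<delta>) * (\<Sum>i\<le>n. u i * s i) = 0"
    using wronskian[of n] pos(1) \<open>s N = 0\<close> by (simp add: N u_def)
  ultimately have "\<delta> = 1 / r" by simp
  then show ?thesis using r by (simp add: power_one_over)
qed

text \<open>For \<open>\<delta> = 0\<close> the square relation makes \<open>gen 2\<close> null, yet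
  it is not orthogonal to \<open>gen 1\<close>.\<close>

lemma not_psd_zero:
  assumes "\<delta> = 0" "L (gen 2 * gen 1) \<noteq> 0"
  shows "\<not> psd"
proof
  assume psd
  have g: "gen k \<in> carrier (free_alg {1..})" if "1 \<le> k" for k using that by (intro gen_closed) auto
  have "L (gen 2 * free_star (gen 2)) = 0"
    using L_sq[of 2 1] assms(1) by (simp add: free_star_gen)
  then have "L (gen 2 * gen 1) = 0" by (intro psd_null[OF \<open>psd\<close> g _ g]) simp_all
  with assms(2) show False by simp
qed

text \<open>If \<open>x\<close> has negative squared norm, the squared norm of
  \<open>x + scal z\<close> for real \<open>z\<close> is a monic quadratic, as
  \<open>L 1 = 1\<close>, and negative at 0. Its two roots give null vectors whose difference is a
  nonzero multiple of 1 and hence not null.\<close>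

lemma psd_if_null_closed:
  assumes closed: "\<And>a b. a \<in> carrier (free_alg {1..}) \<Longrightarrow> b \<in> carrier (free_alg {1..}) \<Longrightarrow>
      L (a * free_star a) = 0 \<Longrightarrow> L (b * free_star b) = 0 \<Longrightarrow> L ((a - b) * free_star (a - b)) = 0"
  shows psd
  unfolding psd_def
proof (rule ballI, rule ccontr)
  fix x assume x: "x \<in> carrier (free_alg {1..})" and "\<not> 0 \<le> Re (L (x * free_star x))"
  then have neg: "Re (L (x * free_star x)) < 0" by simp
  define b where "b = Re (L (x * free_star x))"
  define m where "m = Re (L x)"
  \<comment> \<open>The roots are \<open>- m + e\<close> and \<open>- m - e\<close>; they are
    distinct because \<open>b\<close> is negative.\<close>
  define e where "e = sqrt (m\<^sup>2 - b)"
  have "cnj (L (x * free_star x)) = L (x * free_star x)"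
    using L_star[of "x * free_star x"] by (simp add: free_star_mult free_star_star)
  then have b: "L (x * free_star x) = b"
    by (simp add: b_def complex_eq_iff)
  have "0 < m\<^sup>2 - b" using neg unfolding b_def[symmetric] by (smt (verit) zero_le_power2)
  then have e: "e > 0" "e\<^sup>2 = m\<^sup>2 - b" by (simp_all add: e_def)
  have closed_z: "x + scal z \<in> carrier (free_alg {1..})" for z
    by (intro free_alg_add_closed x scal_closed)
  have form: "L ((x + scal (complex_of_real z)) * free_star (x + scal (complex_of_real z))) = complex_of_real (b + 2 * z * m + z\<^sup>2)"
    for z
  proof -
    have "(x + scal z) * free_star (x + scal z) = x * free_star x + x * scal z + scal z * free_star x
        + scal z * scal z"
      by (simp add: free_star_add free_star_scal algebra_simps)
    also have "x * scal z = scal z * x" by (rule scal_mult_commute)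
    also have "scal (complex_of_real z) * scal z = scal (z * z) * 1" by (simp add: scal_mult)
    finally have "L ((x + scal z) * free_star (x + scal z)) = b + z * (L x + cnj (L x)) + z * z"
      by (simp add: L_add L_scal L_star L_one b distrib_left del: mult_1_right)
    also have "L x + cnj (L x) = 2 * m" by (simp add: complex_add_cnj m_def)
    finally show ?thesis by (simp add: power2_eq_square algebra_simps)
  qed
  have "b + 2 * z * m + z\<^sup>2 = (z + m)\<^sup>2 - e\<^sup>2" for z
    unfolding e(2) by (simp add: power2_eq_square algebra_simps)
  with form have form: "L ((x + scal (complex_of_real z)) * free_star (x + scal (complex_of_real z))) = complex_of_real ((z + m)\<^sup>2 - e\<^sup>2)"
    for z by simp
  let ?u = "x + scal (complex_of_real (e - m))" and ?v = "x + scal (complex_of_real (- e - m))"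
  have "L ((?u - ?v) * free_star (?u - ?v)) = 0"
    using form[of "e - m"] form[of "- e - m"] by (intro closed closed_z) simp_all
  also have "?u - ?v = scal (complex_of_real (2 * e))" by (simp flip: scal_diff)
  also have "scal (complex_of_real (2 * e)) * free_star (scal (complex_of_real (2 * e))) = scal (complex_of_real (4 * e\<^sup>2)) * 1"
    by (simp add: free_star_scal scal_mult power2_eq_square)
  also have "L \<dots> = 4 * e\<^sup>2" by (simp only: L_scal L_one) simp
  finally show False using e(1) by simp
qed

end

section \<open>The Temperley-Lieb algebra as a quotient\<close>

declare One_nat_def [simp del]

lemma free_alg_sel [simp]:
  "add (free_alg S) = (+)" "mult (free_alg S) = (*)" "zero (free_alg S) = 0" "one (free_alg S) = 1"
  by (simp_all add: free_alg_def)

lemma free_alg_uminus_closed: "a \<in> carrier (free_alg S) \<Longrightarrow> - a \<in> carrier (free_alg S)"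
  by (simp add: free_alg_def)

lemma free_alg_zero_closed: "0 \<in> carrier (free_alg S)" and free_alg_one_closed: "1 \<in> carrier (free_alg S)"
  by (simp_all add: free_alg_def zero_tl_word_def)

lemma free_alg_a_inv: "a \<in> carrier (free_alg S) \<Longrightarrow> a_inv (free_alg S) a = - a"
  by (rule abelian_group.minus_equality[OF ring.is_abelian_group[OF ring_free_alg]])
    (simp_all add: free_alg_uminus_closed)

lemma ideal_free_algI:
  assumes sub: "J \<subseteq> carrier (free_alg S)" and "0 \<in> J"
    and add: "\<And>a b. a \<in> J \<Longrightarrow> b \<in> J \<Longrightarrow> a + b \<in> J"
    and neg: "\<And>a. a \<in> J \<Longrightarrow> - a \<in> J"
    and mult: "\<And>a x. a \<in> J \<Longrightarrow> x \<in> carrier (free_alg S) \<Longrightarrow> x * a \<in> J \<and> a * x \<in> J"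
  shows "ideal J (free_alg S)"
proof (rule idealI[OF ring_free_alg])
  show "subgroup J (add_monoid (free_alg S))"
  proof (rule subgroup.intro)
    fix a assume a: "a \<in> J"
    then have "a_inv (free_alg S) a \<in> J" using free_alg_a_inv[of a S] sub neg by auto
    then show "inv\<^bsub>add_monoid (free_alg S)\<^esub> a \<in> J" by (simp add: a_inv_def)
  qed (use sub \<open>0 \<in> J\<close> add in auto)
qed (use mult in auto)

lemma tl_ideal_zero: "0 \<in> tl_ideal d S"
  using additive_subgroup.zero_closed[OF ideal.axioms(1)[OF ideal_tl_ideal], of S d] by simp

lemma tl_ideal_add: "a \<in> tl_ideal d S \<Longrightarrow> b \<in> tl_ideal d S \<Longrightarrow> a + b \<in> tl_ideal d S"
  using additive_subgroup.a_closed[OF ideal.axioms(1)[OF ideal_tl_ideal], of a d S b] by simp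

lemma tl_ideal_mult:
  assumes "a \<in> tl_ideal d S" "x \<in> carrier (free_alg S)"
  shows "x * a \<in> tl_ideal d S" "a * x \<in> tl_ideal d S"
  using ideal.I_l_closed[OF ideal_tl_ideal assms] ideal.I_r_closed[OF ideal_tl_ideal assms] by simp_all

lemma tl_ideal_uminus: "a \<in> tl_ideal d S \<Longrightarrow> - a \<in> tl_ideal d S"
  using tl_ideal_mult(1)[of a d S "- 1"] free_alg_uminus_closed[OF free_alg_one_closed] by simp

lemma tl_relations_sub: "tl_relations d S \<subseteq> tl_ideal d S"
  unfolding tl_ideal_def by (rule ring.genideal_self[OF ring_free_alg tl_relations_closed])

lemma tl_ideal_minimal:
  assumes "ideal J (free_alg S)" "tl_relations d S \<subseteq> J" shows "tl_ideal d S \<subseteq> J"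
  unfolding tl_ideal_def by (rule ring.genideal_minimal[OF ring_free_alg assms])

text \<open>By minimality it suffices that the larger ideal, cut down to the smaller algebra, is an
  ideal containing the smaller set of relations.\<close>

lemma tl_ideal_mono:
  assumes "S \<subseteq> T" shows "tl_ideal d S \<subseteq> tl_ideal d T"
proof -
  have "ideal (tl_ideal d T \<inter> carrier (free_alg S)) (free_alg S)"
    by (rule ideal_free_algI)
      (auto simp: tl_ideal_zero tl_ideal_add tl_ideal_uminus tl_ideal_mult free_alg_zero_closed
        free_alg_add_closed free_alg_uminus_closed free_alg_times_closed free_alg_mono[OF assms])
  moreover have "tl_relations d S \<subseteq> tl_relations d T"
    unfolding tl_relations_def using assms by fast
  ultimately have "tl_ideal d S \<subseteq> tl_ideal d T \<inter> carrier (free_alg S)"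
    using tl_relations_sub[of d T] tl_relations_closed[of d S] by (intro tl_ideal_minimal) auto
  then show ?thesis by blast
qed

lemma free_star_tl_relations:
  assumes "r \<in> tl_relations (complex_of_real \<delta>) S"
  shows "free_star r \<in> tl_relations (complex_of_real \<delta>) S"
proof -
  from assms consider (sq) i where "r = gen i * gen i - scal \<delta> * gen i"
    | (braid) i j where "r = gen i * gen j * gen i - gen i"
    | (comm) i j where "r = gen i * gen j - gen j * gen i" "i \<in> S" "j \<in> S" "\<bar>int i - int j\<bar> > 1"
    unfolding tl_relations_def by blast
  then show ?thesis
  proof cases
    case sq
    then have "free_star r = r"
      by (simp add: free_star_diff free_star_mult free_star_gen free_star_scal scal_mult_commute)
    with assms show ?thesis by simp
  next
    case braid
    then have "free_star r = r" by (simp add: free_star_diff free_star_mult free_star_gen mult.assoc)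
    with assms show ?thesis by simp
  next
    case comm
    then have "free_star r = gen j * gen i - gen i * gen j" "\<bar>int j - int i\<bar> > 1"
      by (simp_all add: free_star_diff free_star_mult free_star_gen)
    with comm(2,3) show ?thesis unfolding tl_relations_def by blast
  qed
qed

text \<open>The elements whose star lies in the ideal form an ideal themselves. It contains the
  relations, which are closed under the star because \<open>\<delta>\<close> is real.\<close>

lemma free_star_tl_ideal:
  assumes "a \<in> tl_ideal (complex_of_real \<delta>) S"
  shows "free_star a \<in> tl_ideal (complex_of_real \<delta>) S"
proof -
  let ?I = "tl_ideal (complex_of_real \<delta>) S"
  let ?J = "{a \<in> carrier (free_alg S). free_star a \<in> ?I}"
  have star_0: "free_star 0 = 0" using free_star_diff[of 0 0] by simp
  have star_neg: "free_star (- b) = - free_star b" for b using free_star_diff[of 0 b] star_0 by simp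
  have "ideal ?J (free_alg S)"
    by (rule ideal_free_algI)
      (auto simp: star_0 star_neg free_star_add free_star_mult free_star_closed tl_ideal_zero tl_ideal_add
        tl_ideal_uminus tl_ideal_mult free_alg_zero_closed free_alg_add_closed free_alg_uminus_closed
        free_alg_times_closed)
  moreover have "tl_relations (complex_of_real \<delta>) S \<subseteq> ?J"
  proof
    fix r assume r: "r \<in> tl_relations (complex_of_real \<delta>) S"
    then have "free_star r \<in> tl_relations (complex_of_real \<delta>) S" by (rule free_star_tl_relations)
    then show "r \<in> ?J" using r tl_relations_sub tl_relations_closed by blast
  qed
  ultimately have "?I \<subseteq> ?J" by (rule tl_ideal_minimal)
  with assms show ?thesis by blast
qed

section \<open>Cosets of the Temperley-Lieb ideal\<close>

definition tl_coset :: "complex \<Rightarrow> nat set \<Rightarrow> free \<Rightarrow> free set" where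
  "tl_coset d S a = (\<lambda>i. i + a) ` tl_ideal d S"

lemma tl_coset_eq: "tl_ideal d S +>\<^bsub>free_alg S\<^esub> a = tl_coset d S a"
  by (auto simp: tl_coset_def a_r_coset_def')

lemma tl_coset_self: "a \<in> tl_coset d S a"
  using tl_ideal_zero[of d S] by (force simp: tl_coset_def)

lemma tl_coset_cong:
  assumes "a - b \<in> tl_ideal d S" shows "tl_coset d S a = tl_coset d S b"
proof -
  have *: "tl_coset d S a \<subseteq> tl_coset d S b" if "a - b \<in> tl_ideal d S" for a b
  proof
    fix x assume "x \<in> tl_coset d S a"
    then obtain i where "x = i + a" "i \<in> tl_ideal d S" by (auto simp: tl_coset_def)
    then have "x = (i + (a - b)) + b" "i + (a - b) \<in> tl_ideal d S" using that by (simp_all add: tl_ideal_add)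
    then show "x \<in> tl_coset d S b" unfolding tl_coset_def by (rule image_eqI)
  qed
  from tl_ideal_uminus[OF assms] have "b - a \<in> tl_ideal d S" by simp
  with * assms show ?thesis by blast
qed

lemma carrier_tl_alg: "carrier (tl_alg d S) = tl_coset d S ` carrier (free_alg S)"
  by (auto simp: tl_alg_simps FactRing_def A_RCOSETS_def' tl_coset_eq)

lemma tl_coset_add:
  assumes "a \<in> carrier (free_alg S)" "b \<in> carrier (free_alg S)"
  shows "tl_coset d S a \<oplus>\<^bsub>tl_alg d S\<^esub> tl_coset d S b = tl_coset d S (a + b)"
  using ring_hom_add[OF ideal.rcos_ring_hom[OF ideal_tl_ideal] assms, of d]
  by (simp add: tl_alg_simps tl_coset_eq)

lemma tl_coset_mult:
  assumes "a \<in> carrier (free_alg S)" "b \<in> carrier (free_alg S)"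
  shows "tl_coset d S a \<otimes>\<^bsub>tl_alg d S\<^esub> tl_coset d S b = tl_coset d S (a * b)"
  using ring_hom_mult[OF ideal.rcos_ring_hom[OF ideal_tl_ideal] assms, of d]
  by (simp add: tl_alg_simps tl_coset_eq)

lemma tl_coset_smult:
  assumes "a \<in> carrier (free_alg S)"
  shows "c \<odot>\<^bsub>tl_alg d S\<^esub> tl_coset d S a = tl_coset d S (scal c * a)"
  using tl_coset_mult[OF scal_closed assms, of d c] by (simp add: tl_alg_simps tl_coset_eq)

lemma tl_star_coset:
  "tl_star (tl_coset (complex_of_real \<delta>) S a) = tl_coset (complex_of_real \<delta>) S (free_star a)"
proof
  let ?I = "tl_ideal (complex_of_real \<delta>) S"
  show "tl_star (tl_coset \<delta> S a) \<subseteq> tl_coset \<delta> S (free_star a)"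
    by (auto simp: tl_star_def tl_coset_def free_star_add free_star_tl_ideal)
  show "tl_coset \<delta> S (free_star a) \<subseteq> tl_star (tl_coset \<delta> S a)"
  proof
    fix x assume "x \<in> tl_coset \<delta> S (free_star a)"
    then obtain i where i: "x = i + free_star a" "i \<in> ?I" by (auto simp: tl_coset_def)
    then have "x = free_star (free_star i + a)" by (simp add: free_star_add free_star_star)
    with free_star_tl_ideal[OF i(2)] show "x \<in> tl_star (tl_coset \<delta> S a)"
      by (auto simp: tl_star_def tl_coset_def)
  qed
qed

lemma TL_incl_coset:
  "TL_incl d (tl_coset d {1..<n} a) = tl_coset d {1..} a"
proof -
  have "{1..<n} \<subseteq> {1::nat..}" by auto
  from tl_ideal_mono[OF this] have *: "i + j \<in> tl_ideal d {1..}"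
    if "i \<in> tl_ideal d {1..}" "j \<in> tl_ideal d {1..<n}" for i j
    using that by (blast intro: tl_ideal_add)
  have "TL_incl d (tl_coset d {1..<n} a) = {i + (j + a) | i j. i \<in> tl_ideal d {1..} \<and> j \<in> tl_ideal d {1..<n}}"
    by (auto simp: TL_incl_def set_add_def' tl_coset_def)
  also have "\<dots> = tl_coset d {1..} a"
  proof (intro equalityI subsetI)
    fix x assume "x \<in> {i + (j + a) | i j. i \<in> tl_ideal d {1..} \<and> j \<in> tl_ideal d {1..<n}}"
    then obtain i j where "x = i + j + a" "i \<in> tl_ideal d {1..}" "j \<in> tl_ideal d {1..<n}"
      by (auto simp: add.assoc)
    with * show "x \<in> tl_coset d {1..} a" by (auto simp: tl_coset_def)
  next
    fix x assume "x \<in> tl_coset d {1..} a"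
    then obtain i where "x = i + (0 + a)" "i \<in> tl_ideal d {1..}" by (auto simp: tl_coset_def)
    with tl_ideal_zero[of d "{1..<n}"]
    show "x \<in> {i + (j + a) | i j. i \<in> tl_ideal d {1..} \<and> j \<in> tl_ideal d {1..<n}}" by blast
  qed
  finally show ?thesis .
qed

lemma std_trace_word: "std_trace d n i (Poly_Mapping.single (Word w) 1) = word_trace d n i w"
  by (simp add: std_trace_def std_matrix_def word_trace_def)

lemma cnj_word_matrix: "cnj (word_matrix (complex_of_real \<delta>) n i w r p) = word_matrix \<delta> n i w r p"
  by (induction w arbitrary: r) (auto simp: gen_matrix_def intro!: sum.cong)

lemma cnj_ext_trace: "cnj (ext_trace (complex_of_real \<delta>) \<gamma> n w) = ext_trace \<delta> \<gamma> n w"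
  by (simp add: ext_trace_def word_trace_def cnj_word_matrix)

text \<open>Words containing the letter 0 do not represent elements of \<open>TL\<^sub>\<infinity>\<close>; giving them the value 0
  makes the functional total without spoiling the trace property.\<close>

definition word_value :: "complex \<Rightarrow> (free set \<Rightarrow> complex) \<Rightarrow> nat list \<Rightarrow> complex" where
  "word_value d \<chi> w = (if 0 \<in> set w then 0 else \<chi> (tl_coset d {1..} (Poly_Mapping.single (Word w) 1)))"

section \<open>The extremal trace as a functional on the free algebra\<close>

locale extremal =
  fixes \<delta> \<gamma> :: real and \<chi> :: "free set \<Rightarrow> complex"
  assumes extremal: "extremal_trace (complex_of_real \<delta>) \<gamma> \<chi>"
begin

abbreviation "A \<equiv> carrier (free_alg {1::nat..})"
abbreviation "X a \<equiv> \<chi> (tl_coset (complex_of_real \<delta>) {1..} a)"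
abbreviation "F \<equiv> word_value (complex_of_real \<delta>) \<chi>"
abbreviation "L \<equiv> lin F"

lemma is_trace_chi: "is_trace (tl_alg (complex_of_real \<delta>) {1..}) \<chi>"
  using extremal by (simp add: extremal_trace_def TL_inf_def)

lemma X_add: "a \<in> A \<Longrightarrow> b \<in> A \<Longrightarrow> X (a + b) = X a + X b"
  using is_trace_chi by (simp add: is_trace_def carrier_tl_alg flip: tl_coset_add)

lemma X_scal: "a \<in> A \<Longrightarrow> X (scal c * a) = c * X a"
  using is_trace_chi by (simp add: is_trace_def carrier_tl_alg flip: tl_coset_smult)

lemma X_commute: "a \<in> A \<Longrightarrow> b \<in> A \<Longrightarrow> X (a * b) = X (b * a)"
  using is_trace_chi by (simp add: is_trace_def carrier_tl_alg flip: tl_coset_mult)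

lemma word_closed: assumes "0 \<notin> set w" shows "Poly_Mapping.single (Word w) c \<in> A"
proof -
  have "1 \<le> k" if "k \<in> set w" for k using assms that by (cases k) auto
  then show ?thesis by (auto simp: free_alg_def)
qed

lemma F_eq: "0 \<notin> set w \<Longrightarrow> F w = X (Poly_Mapping.single (Word w) 1)"
  by (simp add: word_value_def)

lemma X_eq_L: "a \<in> A \<Longrightarrow> X a = L a"
proof (induction rule: free_carrier_induct)
  case (single w c)
  then have w: "0 \<notin> set w" by auto
  have "X (scal c * Poly_Mapping.single (Word w) 1) = c * F w"
    using X_scal[OF word_closed[OF w]] F_eq[OF w] by simp
  also have "scal c * Poly_Mapping.single (Word w) 1 = Poly_Mapping.single (Word w) c"
    by (simp add: scal_def zero_tl_word_def mult_single)
  finally show ?case by (simp add: lin_single)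
qed (simp add: X_add lin_add)

text \<open>A relation multiplied by words on both sides stays in the ideal, so the trace does not
  see it. The coefficient \<open>c\<close> accommodates the square relation; the other two use
  \<open>c = 1\<close>.\<close>

lemma F_relation:
  assumes r: "a - scal c * b \<in> tl_relations (complex_of_real \<delta>) {1..}"
    and a: "a = Poly_Mapping.single (Word x) 1" "b = Poly_Mapping.single (Word y) 1"
    and 0: "0 \<notin> set x" "0 \<notin> set y"
  shows "F (u @ x @ v) = c * F (u @ y @ v)"
proof (cases "0 \<in> set u \<union> set v")
  case True
  then show ?thesis by (auto simp: word_value_def)
next
  case False
  let ?w = "\<lambda>w. Poly_Mapping.single (Word w) 1 :: free"
  have uv: "?w u \<in> A" "?w v \<in> A" using False by (auto intro: word_closed)
  have "?w u * (a - scal c * b) * ?w v \<in> tl_ideal (complex_of_real \<delta>) {1..}"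
    using r tl_relations_sub uv by (blast intro: tl_ideal_mult)
  also have "?w u * (a - scal c * b) * ?w v = ?w (u @ x @ v) - scal c * ?w (u @ y @ v)"
    using scal_mult_commute[of "?w u" c]
    by (simp add: a left_diff_distrib right_diff_distrib mult_single flip: mult.assoc)
      (simp add: mult_single mult.assoc)
  finally have "X (?w (u @ x @ v)) = X (scal c * ?w (u @ y @ v))" by (simp add: tl_coset_cong)
  then show ?thesis using 0 False by (simp add: F_eq X_scal word_closed)
qed

sublocale word: tl_word_trace F "complex_of_real \<delta>"
proof
  fix u v :: "nat list" and i j :: nat
  show "F (u @ v) = F (v @ u)"
  proof (cases "0 \<in> set u \<union> set v")
    case True
    then show ?thesis by (auto simp: word_value_def)
  next
    case False
    then show ?thesis
      using X_commute[of "Poly_Mapping.single (Word u) 1" "Poly_Mapping.single (Word v) 1"]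
      by (simp add: F_eq word_closed mult_single)
  qed
  show "F (u @ [i, i] @ v) = \<delta> * F (u @ [i] @ v)" if "1 \<le> i"
  proof (rule F_relation)
    show "gen i * gen i - scal (complex_of_real \<delta>) * gen i \<in> tl_relations (complex_of_real \<delta>) {1..}"
      using that unfolding tl_relations_def by blast
  qed (use that in \<open>simp_all add: gen_def mult_single\<close>)
  assume ij: "1 \<le> i" "1 \<le> j"
  show "F (u @ [i, j, i] @ v) = F (u @ [i] @ v)" if "j = Suc i \<or> i = Suc j"
  proof -
    from that have that': "j = i + 1 \<or> i = j + 1" by (simp only: Suc_eq_plus1)
    have "F (u @ [i, j, i] @ v) = 1 * F (u @ [i] @ v)"
    proof (rule F_relation)
      have "gen i * gen j * gen i - gen i \<in> tl_relations (complex_of_real \<delta>) {1..}"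
        using that' ij unfolding tl_relations_def by blast
      then show "gen i * gen j * gen i - scal 1 * gen i \<in> tl_relations (complex_of_real \<delta>) {1..}"
        by (simp add: scal_1)
    qed (use ij in \<open>simp_all add: gen_def mult_single\<close>)
    then show ?thesis by simp
  qed
  show "F (u @ [i, j] @ v) = F (u @ [j, i] @ v)" if "Suc i < j \<or> Suc j < i"
  proof -
    have "F (u @ [i, j] @ v) = 1 * F (u @ [j, i] @ v)"
    proof (rule F_relation)
      have "1 < \<bar>int i - int j\<bar>" using that by auto
      then have "gen i * gen j - gen j * gen i \<in> tl_relations (complex_of_real \<delta>) {1..}"
        using ij unfolding tl_relations_def by blast
      then show "gen i * gen j - scal 1 * (gen j * gen i) \<in> tl_relations (complex_of_real \<delta>) {1..}"
        by (simp add: scal_1)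
    qed (use ij in \<open>simp_all add: gen_def mult_single\<close>)
    then show ?thesis by simp
  qed
qed

text \<open>Here the values prescribed on \<open>TL \<delta> n\<close> enter. Any \<open>n\<close>
  above all letters may be chosen, so one word can be evaluated on different numbers of
  points.\<close>

lemma F_ext_trace:
  assumes "set w \<subseteq> {1..<n}" shows "F w = ext_trace \<delta> \<gamma> n w"
proof -
  let ?w = "Poly_Mapping.single (Word w) 1 :: free"
  have "0 \<notin> set w" using assms by auto
  have "?w \<in> carrier (free_alg {1..<n})" using assms by (simp add: free_alg_def)
  then have "tl_coset \<delta> {1..<n} ?w \<in> carrier (TL \<delta> n)" by (simp add: TL_def carrier_tl_alg)
  with extremal have "\<chi> (TL_incl \<delta> (tl_coset \<delta> {1..<n} ?w)) = ext_trace \<delta> \<gamma> n w"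
    using tl_coset_self[of ?w] by (simp add: extremal_trace_def ext_trace_def flip: std_trace_word)
  with \<open>0 \<notin> set w\<close> show ?thesis by (simp add: TL_incl_coset F_eq)
qed

lemma F_rev: "F (rev w) = F w"
  using tl_word_trace_rev[OF word.tl_word_trace_axioms] by (cases "0 \<in> set w") (auto simp: word_value_def)

lemma cnj_F: "cnj (F w) = F w"
proof (cases "0 \<in> set w")
  case False
  then obtain n where "set w \<subseteq> {1..<n}" by (rule letters_bounded)
  from F_ext_trace[OF this] show ?thesis by (simp only: cnj_ext_trace)
qed (simp add: word_value_def)

sublocale tl_functional L \<delta> \<gamma>
proof
  show "L (a * b) = L (b * a)" for a b
  proof (induction a rule: free_induct)
    case (single u c)
    show ?case
      using word.cyc[of u]
      by (induction b rule: free_induct) (simp_all add: mult_single lin_single lin_add algebra_simps)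
  qed (simp add: lin_add algebra_simps)
  show "L (free_star a) = cnj (L a)" for a
    by (induction a rule: free_induct)
      (simp_all add: free_star_single free_star_add lin_single lin_add F_rev cnj_F)
  show "L 1 = 1"
    using F_ext_trace[of "[]" 1] ext_trace_one lin_single[of F "[]" 1]
    by (simp flip: single_one add: zero_tl_word_def del: single_one)
  fix i j :: nat and x :: free
  show "L (gen i * gen i * x) = \<delta> * L (gen i * x)" if "1 \<le> i"
    using word.sq[OF that, of "[]"]
    by (induction x rule: free_induct) (simp_all add: gen_def mult_single lin_single lin_add algebra_simps)
  show "L (gen i * gen j * gen i * x) = L (gen i * x)" if "1 \<le> i" "1 \<le> j" "j = Suc i \<or> i = Suc j"
    using word.braid[OF that, of "[]"]
    by (induction x rule: free_induct) (simp_all add: gen_def mult_single lin_single lin_add distrib_left)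
  show "L (gen i * gen j * x) = L (gen j * gen i * x)" if "1 \<le> i" "1 \<le> j" "Suc i < j \<or> Suc j < i"
    using word.comm[OF that, of "[]"]
    by (induction x rule: free_induct) (simp_all add: gen_def mult_single lin_single lin_add distrib_left)
next
  fix n :: nat and a :: free assume n: "1 \<le> n" and "a \<in> carrier (free_alg {1..<n - 1})"
  from this(2) show "L (gen n * a) = \<gamma> * \<delta> * L a"
  proof (induction rule: free_carrier_induct)
    case (single w c)
    \<comment> \<open>The product is evaluated on \<open>Suc n\<close> points and the remaining word
      on \<open>n - 1\<close> points, as \<open>ext_trace_cup\<close> requires.\<close>
    have "F (n # w) = ext_trace \<delta> \<gamma> (Suc n) (n # w)" using single n by (intro F_ext_trace) fastforce
    also have "\<dots> = \<gamma> * \<delta> * ext_trace \<delta> \<gamma> (n - 1) w" 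
      using ext_trace_cup[OF single n, of \<delta> \<gamma>] by simp
    also have "ext_trace \<delta> \<gamma> (n - 1) w = F w" using single by (intro F_ext_trace[symmetric]) auto
    finally show ?case by (simp add: gen_def mult_single lin_single)
  qed (simp add: lin_add algebra_simps)
qed (simp_all add: lin_add lin_scal)

lemma L_gen21: "L (gen 2 * gen 1) = \<gamma>"
  using F_ext_trace[of "[2, 1]" 3] ext_trace_21[of "complex_of_real \<delta>" \<gamma>]
  by (simp add: gen_def mult_single lin_single)

lemma chi_form_coset:
  assumes "a \<in> A" "b \<in> A"
  shows "chi_form \<delta> \<chi> (tl_coset \<delta> {1..} a) (tl_coset \<delta> {1..} b) = L (a * free_star b)"
  using assms free_star_closed[OF assms(2)]
  by (simp add: chi_form_def TL_inf_def tl_star_coset tl_coset_mult X_eq_L free_alg_times_closed)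

lemma inner_product_chi_form: "inner_product_on (TL_inf \<delta>) (chi_form \<delta> \<chi>)"
  unfolding inner_product_on_def TL_inf_def carrier_tl_alg
  by (auto simp: tl_coset_add tl_coset_smult chi_form_coset free_alg_add_closed free_alg_times_closed
      scal_closed L_add L_scal distrib_right mult.assoc free_star_mult free_star_star simp flip: L_star)

end

text \<open>Zero is a null vector and the form is Hermitian, so failure of indefiniteness can only
  mean that the null vectors form a submodule, which is closed under differences.\<close>

lemma (in extremal) psd_if_not_indefinite:
  assumes "\<not> indefinite_inner_product (TL_inf \<delta>) (chi_form \<delta> \<chi>)"
  shows psd
proof (rule psd_if_null_closed)
  let ?N = "null_vectors (TL_inf \<delta>) (chi_form \<delta> \<chi>)"
  let ?V = "tl_alg (complex_of_real \<delta>) {1..}"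
  let ?c = "tl_coset (complex_of_real \<delta>) {1..}"
  have N: "?c a \<in> ?N \<longleftrightarrow> L (a * free_star a) = 0" if "a \<in> A" for a
    using that by (simp add: null_vectors_def chi_form_coset) (simp add: TL_inf_def carrier_tl_alg)
  have "?c 0 \<in> ?N" using N[OF free_alg_zero_closed] by (simp add: lin_def)
  then have "submodule ?N complex_field ?V"
    using assms inner_product_chi_form by (auto simp: indefinite_inner_product_def TL_inf_def)
  then interpret N: submodule ?N complex_field ?V .
  fix a b assume ab: "a \<in> A" "b \<in> A" and "L (a * free_star a) = 0" "L (b * free_star b) = 0"
  then have "?c a \<in> ?N" "?c b \<in> ?N" by (simp_all add: N)
  then have "?c a \<oplus>\<^bsub>?V\<^esub> (- 1) \<odot>\<^bsub>?V\<^esub> ?c b \<in> ?N"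
    using N.m_closed[of "?c a" "(- 1) \<odot>\<^bsub>?V\<^esub> ?c b"] N.smult_closed[of "- 1" "?c b"]
    by (simp add: complex_field_def)
  also have "?c a \<oplus>\<^bsub>?V\<^esub> (- 1) \<odot>\<^bsub>?V\<^esub> ?c b = ?c (a - b)"
    using ab by (simp add: tl_coset_smult tl_coset_add free_alg_times_closed scal_closed)
      (simp add: scal_minus scal_1)
  finally show "L ((a - b) * free_star (a - b)) = 0" using ab by (simp add: N free_alg_diff_closed)
qed

section \<open>Quantum integers at a root of unity\<close>

lemma quantum_num_root:
  fixes q :: complex
  assumes "q \<noteq> 0" "complex_of_real \<delta> = q + inverse q"
  shows "quantum_num \<delta> n * (q - inverse q) = q ^ Suc n - inverse q ^ Suc n"
proof (induction n rule: induct_nat_012)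
  case (ge2 n)
  have cancel: "q * (inverse q * x) = x" "inverse q * (q * x) = x" for x
    using assms(1) by (simp_all flip: mult.assoc)
  have "quantum_num \<delta> (Suc (Suc n)) * (q - inverse q) =
      (q + inverse q) * (quantum_num \<delta> (Suc n) * (q - inverse q)) - quantum_num \<delta> n * (q - inverse q)"
    by (simp add: assms(2) algebra_simps)
  also have "\<dots> = (q + inverse q) * (q ^ Suc (Suc n) - inverse q ^ Suc (Suc n)) - (q ^ Suc n - inverse q ^ Suc n)"
    by (simp only: ge2)
  also have "\<dots> = q ^ Suc (Suc (Suc n)) - inverse q ^ Suc (Suc (Suc n))"
    by (simp add: algebra_simps cancel)
  finally show ?case .
qed (use assms in \<open>simp_all add: algebra_simps\<close>)

lemma quantum_num_eq_0_iff:
  fixes q :: complex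
  assumes "q \<noteq> 0" "complex_of_real \<delta> = q + inverse q" "q\<^sup>2 \<noteq> 1"
  shows "quantum_num \<delta> n = 0 \<longleftrightarrow> q ^ (2 * Suc n) = 1"
proof -
  \<comment> \<open>This factor is invertible, so the zeros can be read off from the closed form of
    the product.\<close>
  have "q - inverse q \<noteq> 0" using assms(1,3) by (auto simp: field_simps power2_eq_square)
  then have "quantum_num \<delta> n = 0 \<longleftrightarrow> complex_of_real (quantum_num \<delta> n) * (q - inverse q) = 0" by simp
  also have "\<dots> \<longleftrightarrow> q ^ Suc n = inverse (q ^ Suc n)"
    by (simp only: quantum_num_root[OF assms(1,2)] power_inverse right_minus_eq)
  also have "\<dots> \<longleftrightarrow> q ^ Suc n * q ^ Suc n = 1"
    using assms(1) by (auto simp: field_simps)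
  also have "q ^ Suc n * q ^ Suc n = q ^ (2 * Suc n)" by (simp only: mult_2 power_add)
  finally show ?thesis .
qed

theorem theorem7p1:
  fixes q :: complex and l :: nat and \<delta> \<gamma> :: real
    and \<chi> :: "free set \<Rightarrow> complex"
  assumes "q \<noteq> 0"
    and "l \<ge> 2" and "q ^ (2 * l) = 1" and "\<And>m. 0 < m \<Longrightarrow> m < l \<Longrightarrow> q ^ (2 * m) \<noteq> 1"
    and "complex_of_real \<delta> = q + inverse q" and "\<delta> \<ge> 0"
    and "\<gamma> > 0"
    and "extremal_trace (complex_of_real \<delta>) \<gamma> \<chi>"
    and "\<delta> \<noteq> 0 \<Longrightarrow> \<gamma> \<noteq> 1 / \<delta>\<^sup>2"
  shows "indefinite_inner_product (TL_inf (complex_of_real \<delta>)) (chi_form (complex_of_real \<delta>) \<chi>)"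
proof (rule ccontr)
  interpret extremal \<delta> \<gamma> \<chi> using assms(8) by (rule extremal.intro)
  assume "\<not> indefinite_inner_product (TL_inf (complex_of_real \<delta>)) (chi_form (complex_of_real \<delta>) \<chi>)"
  then have psd by (rule psd_if_not_indefinite)
  with not_psd_zero have "\<delta> \<noteq> 0" using L_gen21 \<open>\<gamma> > 0\<close> by auto
  have "q\<^sup>2 \<noteq> 1" using assms(4)[of 1] assms(2) by simp
  note zero_iff = quantum_num_eq_0_iff[OF assms(1,5) this]
  \<comment> \<open>By the index shift, \<open>quantum_num \<delta> (l - 1)\<close> is the quantum
    integer of \<open>l\<close>.\<close>
  have N: "quantum_num \<delta> (l - 1) = 0" using zero_iff[of "l - 1"] assms(2,3) by simp
  \<comment> \<open>For \<open>l = 2\<close> the vanishing number would be \<open>\<delta>\<close>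
    itself; hence \<open>l - 1\<close> is at least 2.\<close>
  have "l \<noteq> 2" using N \<open>\<delta> \<noteq> 0\<close> by auto
  have "\<gamma> = 1 / \<delta>\<^sup>2"
  proof (rule psd_imp_markov[OF \<open>psd\<close> _ \<open>\<gamma> > 0\<close> _ N])
    show "quantum_num \<delta> i \<noteq> 0" if "i < l - 1" for i
      using zero_iff[of i] assms(4)[of "Suc i"] that by simp
  qed (use \<open>\<delta> \<noteq> 0\<close> \<open>l \<noteq> 2\<close> assms(2,6) in auto)
  with assms(9) \<open>\<delta> \<noteq> 0\<close> show False by blast
qed

end
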